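(* Let $1<p<\infty$ and $r>0$. Then there is a constant $C$, independent of the sparse family and of the weights, such that for every sparse collection $\mathcal S$ of dyadic cubes and every pair of weights $w,\sigma$ on $\mathbb R^n$, $$\|A_{\mathcal S}^r(\cdot\,\sigma)\|_{L^p(\sigma)\to L^p(w)}\le C\,[w,\sigma]_{A_p}^{\frac1p}\Big([w]_{A_\infty}^{(\frac1r-\frac1p)_+}+[\sigma]_{A_\infty}^{\frac1p}\Big).$$
   Context: Work in $\mathbb R^n$ with a fixed system $\mathcal D$ of dyadic cubes. A weight is a locally integrable, a.e. positive function; $w(E)=\int_E w\,dx$, and $L^p(w)$ is taken with respect to the measure $w\,dx$. For a cube $Q$, $\langle f\rangle_Q:=\frac1{|Q|}\int_Q f\,dx$. A collection $\mathcal S\subset\mathcal D$ is sparse if there are pairwise disjoint subsets $E(S)\subset S$, $S\in\mathcal S$, with $|E(S)|\ge\frac12|S|$. For $r>0$ and $f\ge0$, $$A_{\mathcal S}^r(f):=\Big(\sum_{Q\in\mathcal S}\langle f\rangle_Q^r\,\mathbf 1_Q\Big)^{1/r}.$$ $\|A_{\mathcal S}^r(\cdot\,\sigma)\|_{L^p(\sigma)\to L^p(w)}$ is the least constant $N\in[0,\infty]$ such that $\|A_{\mathcal S}^r(f\sigma)\|_{L^p(w)}\le N\|f\|_{L^p(\sigma)}$ for all nonnegative $f\in L^p(\sigma)$. The (dyadic) weight characteristics are $$[w,\sigma]_{A_p}:=\sup_{Q\in\mathcal D}\langle w\rangle_Q\langle\sigma\rangle_Q^{p-1},\qquad [w]_{A_\infty}:=\sup_{Q\in\mathcal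 D}\frac1{w(Q)}\int_Q M(\mathbf 1_Q w)\,dx,$$ where $M f=\sup_{Q\in\mathcal D}\langle |f|\rangle_Q\mathbf 1_Q$ is the dyadic maximal operator. Notation: $x_+=\max(x,0)$. By convention $[w]_{A_\infty}^0=1$, whether or not $[w]_{A_\infty}$ is finite. *)

theory Defs
  imports "HOL-Analysis.Analysis"
begin

definition half_open_cube :: "real ^ 'n \<Rightarrow> real \<Rightarrow> (real ^ 'n) set" where
  "half_open_cube a l = {x. \<forall>i. a $ i \<le> x $ i \<and> x $ i < a $ i + l}"

text \<open>
  A general dyadic grid: generation \<open>k\<close> tiles the space by half-open cubes of side \<open>2\<^sup>-\<^sup>k\<close>, and
  generation \<open>k + 1\<close> refines generation \<open>k\<close>.  This covers the standard grid and all its shifts.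
\<close>

definition dyadic_system :: "(real ^ 'n) set set \<Rightarrow> bool" where
  "dyadic_system D \<longleftrightarrow>
     (\<exists>G :: int \<Rightarrow> (real ^ 'n) set set.
        D = (\<Union>k. G k) \<and>
        (\<forall>k. partition_on UNIV (G k)) \<and>
        (\<forall>k. \<forall>Q\<in>G k. \<exists>a. Q = half_open_cube a (2 powi (- k))) \<and>
        (\<forall>k. \<forall>Q\<in>G (k + 1). \<exists>P\<in>G k. Q \<subseteq> P))"

definition sparse_family :: "(real ^ 'n) set set \<Rightarrow> bool" where
  "sparse_family S \<longleftrightarrow>
     (\<exists>E. disjoint_family_on E S \<and>
        (\<forall>Q\<in>S. E Q \<in> sets lebesgue \<and> E Q \<subseteq> Q \<and>
           emeasure lebesgue (E Q) \<ge> ennreal (1 / 2) * emeasure lebesgue Q))"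

text \<open>
  Real powers on \<open>[0, \<infinity>]\<close>, used only for exponents \<open>a \<ge> 0\<close>.  The exponent \<open>0\<close> always gives \<open>1\<close>,
  in particular \<open>\<infinity>\<^sup>0 = 1\<close>.
\<close>

definition ennpowr :: "ennreal \<Rightarrow> real \<Rightarrow> ennreal" where
  "ennpowr x a = (if a = 0 then 1 else if x = \<infinity> then \<infinity> else ennreal (enn2real x powr a))"

text \<open>
  All averages, norms and characteristics below are \<open>[0, \<infinity>]\<close>-valued.  A weight may be negative on
  a null set; the coercion \<^const>\<open>ennreal\<close> replaces these values by \<open>0\<close>.
\<close>

definition weight :: "(real ^ 'n \<Rightarrow> real) \<Rightarrow> bool" where
  "weight w \<longleftrightarrow> (\<forall>K. compact K \<longrightarrow> set_integrable lebesgue K w) \<and> (AE x in lebesgue. w x > 0)"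

definition weight_measure :: "(real ^ 'n \<Rightarrow> real) \<Rightarrow> (real ^ 'n) measure" where
  "weight_measure w = density lebesgue (\<lambda>x. ennreal (w x))"

definition average :: "(real ^ 'n \<Rightarrow> ennreal) \<Rightarrow> (real ^ 'n) set \<Rightarrow> ennreal" where
  "average f Q = (\<integral>\<^sup>+x\<in>Q. f x \<partial>lebesgue) / emeasure lebesgue Q"

definition dyadic_maximal ::
    "(real ^ 'n) set set \<Rightarrow> (real ^ 'n \<Rightarrow> real) \<Rightarrow> real ^ 'n \<Rightarrow> ennreal" where
  "dyadic_maximal D f x = (SUP Q\<in>D. average (\<lambda>y. ennreal \<bar>f y\<bar>) Q * indicator Q x)"

definition Ap_char ::
    "(real ^ 'n) set set \<Rightarrow> real \<Rightarrow> (real ^ 'n \<Rightarrow> real) \<Rightarrow> (real ^ 'n \<Rightarrow> real) \<Rightarrow> ennreal" where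
  "Ap_char D p w \<sigma> = (SUP Q\<in>D. average (\<lambda>x. ennreal (w x)) Q * ennpowr (average (\<lambda>x. ennreal (\<sigma> x)) Q) (p - 1))"

definition Ainf_char :: "(real ^ 'n) set set \<Rightarrow> (real ^ 'n \<Rightarrow> real) \<Rightarrow> ennreal" where
  "Ainf_char D w =
     (SUP Q\<in>D. (\<integral>\<^sup>+x\<in>Q. dyadic_maximal D (\<lambda>y. indicator Q y * w y) x \<partial>lebesgue)
                 / emeasure (weight_measure w) Q)"

definition sparse_operator ::
    "(real ^ 'n) set set \<Rightarrow> real \<Rightarrow> (real ^ 'n \<Rightarrow> real) \<Rightarrow> real ^ 'n \<Rightarrow> ennreal" where
  "sparse_operator S r f x =
     ennpowr (\<Sum>\<^sub>\<infinity>Q\<in>S. ennpowr (average (\<lambda>y. ennreal (f y)) Q) r * indicator Q x) (1 / r)"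

definition Lp_norm :: "real \<Rightarrow> (real ^ 'n \<Rightarrow> real) \<Rightarrow> (real ^ 'n \<Rightarrow> ennreal) \<Rightarrow> ennreal" where
  "Lp_norm p w g = ennpowr (\<integral>\<^sup>+x. ennpowr (g x) p \<partial>weight_measure w) (1 / p)"

text \<open>
  The least \<open>N\<close> with \<open>\<parallel>A(f \<sigma>)\<parallel> \<le> N \<parallel>f\<parallel>\<close>, the norms being those of \<open>L\<^sup>p(w)\<close> and \<open>L\<^sup>p(\<sigma>)\<close>, and \<open>f\<close>
  ranging over the nonnegative functions in \<open>L\<^sup>p(\<sigma>)\<close>.
\<close>

definition sparse_operator_norm ::
    "(real ^ 'n) set set \<Rightarrow> real \<Rightarrow> real \<Rightarrow> (real ^ 'n \<Rightarrow> real) \<Rightarrow> (real ^ 'n \<Rightarrow> real) \<Rightarrow> ennreal" where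
  "sparse_operator_norm S r p \<sigma> w =
     Inf {N. \<forall>f. f \<in> borel_measurable lebesgue \<and> (\<forall>x. f x \<ge> 0) \<and> Lp_norm p \<sigma> (\<lambda>x. ennreal (f x)) < \<infinity> \<longrightarrow>
               Lp_norm p w (sparse_operator S r (\<lambda>x. f x * \<sigma> x)) \<le> N * Lp_norm p \<sigma> (\<lambda>x. ennreal (f x))}"

end

theory Submission
  imports Defs
begin

text \<open>
  By monotone convergence it suffices to treat finite \<open>S\<close>, with a bound that does not depend on
  \<open>S\<close>; and all characteristics that occur with a positive exponent may be taken finite.

  A finite set of dyadic cubes is laminar: the members containing a given point, or a given cube,
  form a chain.  Stopping cubes are therefore replaced by summation by parts along these chains.  For
  a function \<open>F\<close> of finite sets of cubes, its \<^emph>\<open>jump\<close> at \<open>R\<close> is the difference of the values of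
  \<open>F\<close> on the cubes containing \<open>R\<close> and on those strictly containing \<open>R\<close>.  The jumps telescope along
  every chain, so if \<open>F\<close> is increasing and a weight \<open>m\<close> on cubes packs, that is,
  \<open>\<Sum>\<^bsub>Q \<subseteq> R\<^esub> m(Q) \<le> K m(R)\<close>, then \<open>\<Sum>\<^sub>Q F(Q) m(Q) \<le> K \<Sum>\<^sub>R (jump at R) m(R)\<close>
  (\<open>sum_le_sum_jump\<close>); and if \<open>m\<close> is a measure, the right-hand sum is the integral of \<open>F\<close> over the
  cubes containing \<open>x\<close> (\<open>sum_jump_integral\<close>).  With \<open>F\<close> a function of the largest average among
  the cubes, the first fact is the Carleson embedding and the second one leads to the maximal
  inequality (\<open>maximal_inequality\<close>).

  Sparseness makes Lebesgue measure pack with constant \<open>2\<close> and \<open>\<sigma>\<close> with constant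
  \<open>2 [\<sigma>]\<close>, where \<open>[\<sigma>]\<close> is the \<open>A\<^sub>\<infinity>\<close> characteristic.  Write \<open>\<langle>\<cdot>\<rangle>\<^sub>Q\<close> for averages, \<open>A\<close> for the \<open>A\<^sub>p\<close>
  characteristic, and \<open>a\<^sub>Q\<close> for the average of \<open>f\<close> with respect to \<open>\<sigma>\<close>.

  For \<open>r \<ge> p\<close>, subadditivity of \<open>t \<mapsto> t\<^bsup>p/r\<^esup>\<close> bounds the \<open>p\<close>-th power of the norm by
  \<open>\<Sum>\<^sub>Q \<langle>f\<sigma>\<rangle>\<^sub>Q\<^bsup>p\<^esup> w(Q) \<le> A \<Sum>\<^sub>Q a\<^sub>Q\<^bsup>p\<^esup> \<sigma>(Q)\<close>, and the Carleson embedding concludes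
  (\<open>family_sum_bound_large_exponent\<close>).

  For \<open>r < p\<close> put \<open>t = r/p\<close>.  Pairing \<open>h = \<Sum>\<^sub>Q \<langle>f\<sigma>\<rangle>\<^sub>Q\<^bsup>r\<^esup> 1\<^sub>Q\<close> with \<open>g = h\<^bsup>1/t - 1\<^esup>\<close> leaves the sum
  of \<open>a\<^sub>Q\<^bsup>r\<^esup> b\<^sub>Q \<mu>\<^sub>Q\<close>, where \<open>b\<^sub>Q\<close> is the average of \<open>g\<close> with respect to \<open>w\<close> and
  \<open>\<mu>\<^sub>Q = \<langle>\<sigma>\<rangle>\<^sub>Q\<^bsup>r\<^esup> w(Q)\<close>.  Two estimates of \<open>\<mu>\<close> combine.  First, \<open>\<mu>\<^sub>Q\<close> is at most
  \<open>A\<^bsup>t\<^esup> \<sigma>(Q)\<^bsup>t\<^esup> w(Q)\<^bsup>1-t\<^esup>\<close>, which suits Hoelder's inequality; used alone it would produce the product of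
  the two \<open>A\<^sub>\<infinity>\<close> powers.  Secondly, if \<open>\<langle>w\<rangle>\<^sub>Q \<langle>\<sigma>\<rangle>\<^sub>Q\<^bsup>p-1\<^esup>\<close> is constant up to a factor \<open>2\<close>, then \<open>\<mu>\<close>
  itself packs with a constant depending only on \<open>p\<close> and \<open>r\<close> (\<open>slice_packing\<close>): up to that factor, \<open>\<mu>\<^sub>Q\<close> is a
  constant times \<open>\<langle>\<sigma>\<rangle>\<^sub>Q\<^bsup>\<alpha>\<^esup>|Q|\<close> or \<open>\<langle>w\<rangle>\<^sub>Q\<^bsup>\<alpha>\<^esup>|Q|\<close> with \<open>0 \<le> \<alpha> < 1\<close>, and these pack
  (\<open>packing_powr_average\<close>, a form of Kolmogorov's inequality).  So on such a slice one may sum by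
  parts in \<open>\<mu>\<close> first.  The jump of the product of the two maximal averages splits by the product
  rule into two terms, each containing a jump of only one factor.  By Hoelder, the factor with the
  jump costs no \<open>A\<^sub>\<infinity>\<close> constant and the other factor costs that of its own weight.  This is why the
  \<^emph>\<open>sum\<close> of the two \<open>A\<^sub>\<infinity>\<close> powers appears (\<open>bilinear_packing_bound\<close>).  The slices
  \<open>\<langle>w\<rangle>\<^sub>Q \<langle>\<sigma>\<rangle>\<^sub>Q\<^bsup>p-1\<^esup> \<approx> 2\<^bsup>-k\<^esup> A\<close> are summed as a geometric series, since each bound is proportional to the
  power \<open>t\<close> of its value of \<open>A\<close> (\<open>bilinear_bound\<close>).
\<close>

section \<open>Inequalities between real powers\<close>

lemma powr_diff_le:
  fixes x y t :: real
  assumes "0 \<le> y" "y \<le> x" "0 < t" "t \<le> 1"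
  shows "x powr t - y powr t \<le> (x - y) powr t"
proof (cases "x = 0")
  case False
  have *: "z * x powr (t - 1) \<le> z powr t" if "0 \<le> z" "z \<le> x" for z
  proof (cases "z = 0")
    case False
    then have "x powr (t - 1) \<le> z powr (t - 1)"
      using that assms by (intro powr_mono2') auto
    then have "z * x powr (t - 1) \<le> z * z powr (t - 1)"
      using that by (intro mult_left_mono) auto
    also have "\<dots> = z powr t"
      using powr_mult_base[OF that(1), of "t - 1"] by simp
    finally show ?thesis .
  qed simp
  have "x powr t = (x - y) * x powr (t - 1) + y * x powr (t - 1)"
    using powr_mult_base[of x "t - 1"] assms by (simp add: algebra_simps)
  then show ?thesis
    using *[of "x - y"] *[of y] assms by simp
qed (use assms in auto)

lemma powr_sum_le:
  fixes c :: "'a \<Rightarrow> real"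
  assumes "finite S" "\<And>Q. Q \<in> S \<Longrightarrow> 0 \<le> c Q" "0 < t" "t \<le> 1"
  shows "(\<Sum>Q\<in>S. c Q) powr t \<le> (\<Sum>Q\<in>S. c Q powr t)"
  using assms(1,2)
proof (induction S rule: finite_induct)
  case (insert Q S)
  have "(c Q + sum c S) powr t - sum c S powr t \<le> c Q powr t"
    using powr_diff_le[of "sum c S" "c Q + sum c S" t] insert.prems assms(3,4)
    by (simp add: sum_nonneg)
  then show ?case using insert by simp
qed simp

text \<open>
  This discretises \<open>d(x\<^bsup>p\<^esup>) = p/(p - 1) x d(x\<^bsup>p-1\<^esup>)\<close>: it trades a jump of the \<open>p\<close>-th power for one of
  the \<open>(p - 1)\<close>-th power and a factor \<open>x\<close>, which is an average in the maximal inequality.  It is Young's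
  inequality for \<open>y\<^bsup>p-1\<^esup> x\<close>.
\<close>

lemma powr_diff_le_conjugate:
  fixes x y p :: real
  assumes "1 < p" "0 \<le> y" "y \<le> x" "0 < x"
  shows "x powr p - y powr p \<le> p / (p - 1) * (x powr (p - 1) - y powr (p - 1)) * x"
proof -
  have "p * (y powr (p - 1) * x) \<le> (p - 1) * y powr p + x powr p"
  proof (cases "y = 0")
    case False
    have "(y powr p) powr ((p - 1) / p) * (x powr p) powr (1 / p)
        \<le> (p - 1) / p * y powr p + 1 / p * x powr p"
      using assms False by (intro Youngs_inequality_0) (auto simp: field_simps)
    moreover have "(y powr p) powr ((p - 1) / p) * (x powr p) powr (1 / p) = y powr (p - 1) * x"
      using assms by (simp add: powr_powr)
    ultimately have "p * (y powr (p - 1) * x) \<le> p * ((p - 1) / p * y powr p + 1 / p * x powr p)"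
      using assms by (intro mult_left_mono) auto
    then show ?thesis using assms by (simp add: distrib_left)
  qed (use assms in simp)
  moreover have "x powr (p - 1) * x = x powr p"
    using powr_mult_base[of x "p - 1"] assms by (simp add: mult.commute)
  ultimately have "(p - 1) * (x powr p - y powr p) \<le> p * (x powr (p - 1) - y powr (p - 1)) * x"
    by (simp add: algebra_simps)
  then show ?thesis using assms by (simp add: field_simps)
qed

text \<open>
  The counterpart for exponents below \<open>1\<close>, where the power \<open>\<alpha> - 1\<close> on the right is decreasing.  It is
  Young's inequality for a product whose powers of \<open>y\<close> cancel.
\<close>

lemma powr_diff_le_negative_power:
  fixes x y \<alpha> :: real
  assumes "0 \<le> \<alpha>" "\<alpha> < 1" "0 < y" "y \<le> x"
  shows "x powr \<alpha> - y powr \<alpha> \<le> \<alpha> / (1 - \<alpha>) * (y powr (\<alpha> - 1) - x powr (\<alpha> - 1)) * x"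
proof -
  have "(y powr (\<alpha> - 1) * x) powr \<alpha> * (y powr \<alpha>) powr (1 - \<alpha>)
      \<le> \<alpha> * (y powr (\<alpha> - 1) * x) + (1 - \<alpha>) * y powr \<alpha>"
    using assms by (intro Youngs_inequality_0) auto
  moreover have "(y powr (\<alpha> - 1) * x) powr \<alpha> * (y powr \<alpha>) powr (1 - \<alpha>) = x powr \<alpha>"
  proof -
    have "(y powr (\<alpha> - 1) * x) powr \<alpha> * (y powr \<alpha>) powr (1 - \<alpha>)
        = y powr ((\<alpha> - 1) * \<alpha> + \<alpha> * (1 - \<alpha>)) * x powr \<alpha>"
      using assms by (simp add: powr_mult powr_powr powr_add)
    also have "(\<alpha> - 1) * \<alpha> + \<alpha> * (1 - \<alpha>) = 0" by algebra
    finally show ?thesis using assms by simp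
  qed
  moreover have "x powr (\<alpha> - 1) * x = x powr \<alpha>"
    using powr_mult_base[of x "\<alpha> - 1"] assms by (simp add: mult.commute)
  ultimately have "(1 - \<alpha>) * (x powr \<alpha> - y powr \<alpha>) \<le> \<alpha> * (y powr (\<alpha> - 1) - x powr (\<alpha> - 1)) * x"
    by (simp add: algebra_simps)
  then show ?thesis using assms by (simp add: field_simps)
qed

text \<open>
  Taking the place of Hoelder's inequality for integrals: the first term on the right is absorbed
  when \<open>\<delta>\<close> is small.
\<close>

lemma mult_powr_le_add:
  fixes f m p \<delta> :: real
  assumes "1 < p" "0 \<le> f" "0 \<le> m" "0 < \<delta>"
  shows "f * m powr (p - 1) \<le> \<delta> * m powr p + \<delta> powr (1 - p) * f powr p"
proof (cases "f \<le> \<delta> * m")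
  case True
  then have "f * m powr (p - 1) \<le> (\<delta> * m) * m powr (p - 1)"
    by (intro mult_right_mono) auto
  also have "\<dots> = \<delta> * m powr p"
    using powr_mult_base[of m "p - 1"] assms by simp
  finally show ?thesis using assms by (simp add: add_increasing2)
next
  case False
  then have "m \<le> f / \<delta>" using assms by (simp add: field_simps)
  then have "f * m powr (p - 1) \<le> f * (f / \<delta>) powr (p - 1)"
    using assms by (intro mult_left_mono powr_mono2) auto
  also have "\<dots> = \<delta> powr (1 - p) * f powr p"
    using powr_mult_base[of f "p - 1"] assms
    by (simp add: powr_divide powr_diff field_simps)
  finally show ?thesis using assms by (simp add: add_increasing)
qed

lemma Holder_sum:
  fixes x y :: "'a \<Rightarrow> real"
  assumes t: "0 < t" "t < 1" and nonneg: "\<And>i. i \<in> I \<Longrightarrow> 0 \<le> x i" "\<And>i. i \<in> I \<Longrightarrow> 0 \<le> y i"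
  shows "(\<Sum>i\<in>I. x i powr t * y i powr (1 - t)) \<le> (\<Sum>i\<in>I. x i) powr t * (\<Sum>i\<in>I. y i) powr (1 - t)"
proof (cases "finite I \<and> sum x I > 0 \<and> sum y I > 0")
  case True
  let ?X = "sum x I" and ?Y = "sum y I"
  have "(x i / ?X) powr t * (y i / ?Y) powr (1 - t) \<le> t * (x i / ?X) + (1 - t) * (y i / ?Y)"
    if "i \<in> I" for i
  proof (cases "x i = 0 \<or> y i = 0")
    case True
    then show ?thesis using assms that \<open>finite I \<and> ?X > 0 \<and> ?Y > 0\<close> by auto
  next
    case False
    then have "0 < x i" "0 < y i" using nonneg[OF that] by auto
    then show ?thesis using assms True by (intro Youngs_inequality_0) auto
  qed
  then have "(\<Sum>i\<in>I. (x i / ?X) powr t * (y i / ?Y) powr (1 - t))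
      \<le> (\<Sum>i\<in>I. t * (x i / ?X) + (1 - t) * (y i / ?Y))"
    by (rule sum_mono)
  also have "\<dots> = t * (?X / ?X) + (1 - t) * (?Y / ?Y)"
    by (simp only: sum.distrib sum_divide_distrib sum_distrib_left)
  also have "\<dots> = 1" using True by simp
  finally have "(\<Sum>i\<in>I. x i powr t * y i powr (1 - t)) / (?X powr t * ?Y powr (1 - t)) \<le> 1"
    using True nonneg by (simp add: powr_divide sum_divide_distrib)
  then show ?thesis using True by (simp add: field_simps)
next
  case False
  then consider "infinite I" | "finite I" "sum x I = 0" | "finite I" "sum y I = 0"
    using nonneg sum_nonneg[of I x] sum_nonneg[of I y] by force
  then have "(\<Sum>i\<in>I. x i powr t * y i powr (1 - t)) = 0"
  proof cases
    case 2
    then have "\<forall>i\<in>I. x i = 0" using nonneg by (simp add: sum_nonneg_eq_0_iff)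
    then show ?thesis by simp
  next
    case 3
    then have "\<forall>i\<in>I. y i = 0" using nonneg by (simp add: sum_nonneg_eq_0_iff)
    then show ?thesis by simp
  qed simp
  then show ?thesis by simp
qed

section \<open>Summation by parts on a laminar family\<close>

definition laminar :: "'a set set \<Rightarrow> bool" where
  "laminar S \<longleftrightarrow> (\<forall>P\<in>S. \<forall>Q\<in>S. P \<subseteq> Q \<or> Q \<subseteq> P \<or> P \<inter> Q = {})"

text \<open>
  A function on cubes is written as a function \<open>F\<close> of the set of their ancestors, the cube itself
  included.  Then the value at the parent is \<open>F\<close> of the strict ancestors, and no parent map with its
  special case for maximal cubes is needed.  The telescoping covers products and negative powers of
  maximal averages alike.
\<close>

definition jump :: "('a set set \<Rightarrow> real) \<Rightarrow> 'a set set \<Rightarrow> 'a set \<Rightarrow> real" where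
  "jump F S R = F {P\<in>S. R \<subseteq> P} - F {P\<in>S. R \<subset> P}"

lemma laminar_subset: "laminar S \<Longrightarrow> T \<subseteq> S \<Longrightarrow> laminar T"
  unfolding laminar_def by blast

text \<open>
  Removing the smallest member of a chain leaves exactly its strict ancestors.
\<close>

lemma sum_jump_chain:
  assumes "finite C" "\<And>P Q. P \<in> C \<Longrightarrow> Q \<in> C \<Longrightarrow> P \<subseteq> Q \<or> Q \<subseteq> P"
  shows "(\<Sum>R\<in>C. jump F C R) = F C - F {}"
  using assms
proof (induction C rule: finite_psubset_induct)
  case (psubset C)
  show ?case
  proof (cases "C = {}")
    case False
    then obtain Q where Q: "Q \<in> C" "\<And>P. P \<in> C \<Longrightarrow> P \<subseteq> Q \<Longrightarrow> P = Q"
      using finite_has_minimal[OF psubset.hyps(1)] by metis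
    let ?C = "C - {Q}"
    have up: "{P\<in>C. Q \<subseteq> P} = C" "{P\<in>C. Q \<subset> P} = ?C"
      using Q psubset.prems by blast+
    have "jump F C R = jump F ?C R" if "R \<in> ?C" for R
    proof -
      have "\<not> R \<subseteq> Q" using Q that by blast
      then have "{P\<in>C. R \<subseteq> P} = {P\<in>?C. R \<subseteq> P}" "{P\<in>C. R \<subset> P} = {P\<in>?C. R \<subset> P}"
        by blast+
      then show ?thesis by (simp add: jump_def)
    qed
    then have "(\<Sum>R\<in>?C. jump F C R) = F ?C - F {}"
      using psubset.IH[of ?C] psubset.prems Q(1) by auto
    then show ?thesis
      using sum.remove[OF psubset.hyps(1) Q(1), of "jump F C"] up by (simp add: jump_def)
  qed simp
qed

lemma sum_jump_upset:
  assumes "finite S" "C \<subseteq> S" "\<And>P R. R \<in> C \<Longrightarrow> P \<in> S \<Longrightarrow> R \<subseteq> P \<Longrightarrow> P \<in> C"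
    and "\<And>P Q. P \<in> C \<Longrightarrow> Q \<in> C \<Longrightarrow> P \<subseteq> Q \<or> Q \<subseteq> P"
  shows "(\<Sum>R\<in>C. jump F S R) = F C - F {}"
proof -
  have "jump F S R = jump F C R" if "R \<in> C" for R
  proof -
    have "{P\<in>S. R \<subseteq> P} = {P\<in>C. R \<subseteq> P}" "{P\<in>S. R \<subset> P} = {P\<in>C. R \<subset> P}"
      using that assms(2,3) by blast+
    then show ?thesis by (simp add: jump_def)
  qed
  then have "(\<Sum>R\<in>C. jump F S R) = (\<Sum>R\<in>C. jump F C R)" by simp
  also have "\<dots> = F C - F {}"
    using assms(4) by (rule sum_jump_chain[OF finite_subset[OF assms(2,1)]])
  finally show ?thesis .
qed

lemma sum_jump_point:
  assumes "finite S" "laminar S"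
  shows "(\<Sum>R | R \<in> S \<and> x \<in> R. jump F S R) = F {R\<in>S. x \<in> R} - F {}"
proof (rule sum_jump_upset[OF assms(1)])
  show "P \<subseteq> Q \<or> Q \<subseteq> P" if "P \<in> {R\<in>S. x \<in> R}" "Q \<in> {R\<in>S. x \<in> R}" for P Q
    using that assms(2) unfolding laminar_def by blast
qed auto

lemma sum_jump_above:
  assumes "finite S" "laminar S" "Q \<noteq> {}"
  shows "(\<Sum>R | R \<in> S \<and> Q \<subseteq> R. jump F S R) = F {R\<in>S. Q \<subseteq> R} - F {}"
proof (rule sum_jump_upset[OF assms(1)])
  obtain x where "x \<in> Q" using assms(3) by blast
  then show "P \<subseteq> P' \<or> P' \<subseteq> P" if "P \<in> {R\<in>S. Q \<subseteq> R}" "P' \<in> {R\<in>S. Q \<subseteq> R}" for P P'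
    using that assms(2) unfolding laminar_def by blast
qed auto

text \<open>
  The Carleson packing condition.
\<close>

definition packing :: "real \<Rightarrow> 'a set set \<Rightarrow> ('a set \<Rightarrow> real) \<Rightarrow> bool" where
  "packing K S m \<longleftrightarrow> (\<forall>R\<in>S. (\<Sum>Q | Q \<in> S \<and> Q \<subseteq> R. m Q) \<le> K * m R)"

text \<open>
  Each value of \<open>F\<close> is the sum of the jumps at the ancestors; interchanging the two sums brings in
  the packing sums, once for each jump.
\<close>

lemma sum_le_sum_jump:
  assumes S: "finite S" "laminar S" "{} \<notin> S"
    and F: "F {} = 0" "\<And>R. R \<in> S \<Longrightarrow> 0 \<le> jump F S R"
    and m: "packing K S m"
  shows "(\<Sum>Q\<in>S. F {P\<in>S. Q \<subseteq> P} * m Q) \<le> K * (\<Sum>R\<in>S. jump F S R * m R)"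
proof -
  have "(\<Sum>Q\<in>S. F {P\<in>S. Q \<subseteq> P} * m Q) = (\<Sum>Q\<in>S. \<Sum>R | R \<in> S \<and> Q \<subseteq> R. jump F S R * m Q)"
  proof (rule sum.cong)
    fix Q assume "Q \<in> S"
    then have "F {P\<in>S. Q \<subseteq> P} = (\<Sum>R | R \<in> S \<and> Q \<subseteq> R. jump F S R)"
      using sum_jump_above[OF S(1,2), of Q F] S(3) F(1) by force
    then show "F {P\<in>S. Q \<subseteq> P} * m Q = (\<Sum>R | R \<in> S \<and> Q \<subseteq> R. jump F S R * m Q)"
      by (simp add: sum_distrib_right)
  qed simp
  also have "\<dots> = (\<Sum>R\<in>S. \<Sum>Q | Q \<in> S \<and> Q \<subseteq> R. jump F S R * m Q)"
    by (rule sum.swap_restrict[OF S(1,1)])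
  also have "\<dots> \<le> (\<Sum>R\<in>S. jump F S R * (K * m R))"
  proof (rule sum_mono)
    fix R assume R: "R \<in> S"
    show "(\<Sum>Q | Q \<in> S \<and> Q \<subseteq> R. jump F S R * m Q) \<le> jump F S R * (K * m R)"
      using m R F(2)[OF R] unfolding packing_def
      by (simp add: mult_left_mono flip: sum_distrib_left)
  qed
  also have "\<dots> = K * (\<Sum>R\<in>S. jump F S R * m R)"
    by (simp add: sum_distrib_left mult_ac)
  finally show ?thesis .
qed

text \<open>
  The same telescoping, done at a point: the jumps at the cubes containing \<open>x\<close> add
  up to \<open>F\<close> of these cubes.
\<close>

lemma
  fixes f :: "'a \<Rightarrow> real"
  assumes S: "finite S" "laminar S" and F: "F {} = 0"
    and f: "\<And>R. R \<in> S \<Longrightarrow> set_integrable m R f"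
  shows sum_jump_integral:
      "(\<Sum>R\<in>S. jump F S R * (LINT x:R|m. f x)) = (LINT x|m. F {R\<in>S. x \<in> R} * f x)"
    and integrable_on_family: "integrable m (\<lambda>x. F {R\<in>S. x \<in> R} * f x)"
proof -
  have eq: "F {R\<in>S. x \<in> R} * f x = (\<Sum>R\<in>S. jump F S R * (indicator R x * f x))" for x
  proof -
    have "(\<Sum>R\<in>S. jump F S R * (indicator R x * f x))
        = (\<Sum>R\<in>S. if x \<in> R then jump F S R * f x else 0)"
      by (rule sum.cong) auto
    also have "\<dots> = (\<Sum>R | R \<in> S \<and> x \<in> R. jump F S R * f x)"
      using S(1) by (simp add: sum.If_cases Collect_conj_eq Int_commute)
    also have "\<dots> = (\<Sum>R | R \<in> S \<and> x \<in> R. jump F S R) * f x"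
      by (simp add: sum_distrib_right)
    finally show ?thesis using sum_jump_point[OF S, of F x] F by simp
  qed
  have int: "integrable m (\<lambda>x. jump F S R * (indicator R x * f x))" if "R \<in> S" for R
    using f[OF that] by (simp add: set_integrable_def)
  show "integrable m (\<lambda>x. F {R\<in>S. x \<in> R} * f x)"
    unfolding eq by (intro Bochner_Integration.integrable_sum int)
  show "(\<Sum>R\<in>S. jump F S R * (LINT x:R|m. f x)) = (LINT x|m. F {R\<in>S. x \<in> R} * f x)"
    unfolding eq using int
    by (subst Bochner_Integration.integral_sum) (auto simp: set_lebesgue_integral_def)
qed

text \<open>
  The \<open>0\<close> gives the empty family the maximum \<open>0\<close>; it is harmless because only nonnegative \<open>a\<close> are
  used.
\<close>

definition fam_max :: "('a \<Rightarrow> real) \<Rightarrow> 'a set \<Rightarrow> real" where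
  "fam_max a C = Max (insert 0 (a ` C))"

lemma fam_max_empty [simp]: "fam_max a {} = 0"
  by (simp add: fam_max_def)

lemma fam_max_nonneg: "finite C \<Longrightarrow> 0 \<le> fam_max a C"
  by (simp add: fam_max_def)

lemma fam_max_upper: "finite C \<Longrightarrow> Q \<in> C \<Longrightarrow> a Q \<le> fam_max a C"
  by (simp add: fam_max_def)

lemma fam_max_mono: "finite D \<Longrightarrow> C \<subseteq> D \<Longrightarrow> fam_max a C \<le> fam_max a D"
  unfolding fam_max_def by (rule Max_mono) auto

lemma fam_max_insert:
  assumes "finite C" shows "fam_max a (insert Q C) = max (a Q) (fam_max a C)"
proof -
  have "insert 0 (a ` insert Q C) = insert (a Q) (insert 0 (a ` C))" by auto
  then show ?thesis using assms by (simp add: fam_max_def)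
qed

lemma fam_max_powr:
  assumes "finite C" "\<And>Q. Q \<in> C \<Longrightarrow> 0 \<le> a Q" "0 < t"
  shows "fam_max (\<lambda>Q. a Q powr t) C = fam_max a C powr t"
  using assms(1,2)
proof (induction C rule: finite_induct)
  case (insert Q C)
  have "max (a Q powr t) (m powr t) = max (a Q) m powr t" if "0 \<le> m" for m
    using insert.prems[of Q] assms(3) that
    by (cases "a Q \<le> m") (auto simp: max_def powr_mono2 not_le dest: powr_less_mono2[rotated 2])
  then show ?case
    using insert by (simp add: fam_max_insert fam_max_nonneg)
qed simp

lemma fam_max_above:
  assumes "finite S" "R \<in> S"
  shows "fam_max a {P\<in>S. R \<subseteq> P} = max (a R) (fam_max a {P\<in>S. R \<subset> P})"
proof -
  have "{P\<in>S. R \<subseteq> P} = insert R {P\<in>S. R \<subset> P}" using assms by auto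
  then show ?thesis using assms by (simp add: fam_max_insert)
qed

lemma jump_fam_max_nonneg: "finite S \<Longrightarrow> 0 \<le> jump (fam_max a) S R"
  unfolding jump_def by (simp, rule fam_max_mono) auto

section \<open>Maximal averages\<close>

locale measured_family =
  fixes S :: "'a set set" and m :: "'a measure"
  assumes finite_family: "finite S" and laminar_family: "laminar S"
    and family_sets: "R \<in> S \<Longrightarrow> R \<in> sets m"
    and family_finite: "R \<in> S \<Longrightarrow> emeasure m R < \<infinity>"
    and family_pos: "R \<in> S \<Longrightarrow> 0 < measure m R"
begin

lemma empty_notin: "{} \<notin> S"
  using family_pos by force

lemma subfamily: "T \<subseteq> S \<Longrightarrow> measured_family T m"
  using finite_family laminar_subset[OF laminar_family, of T] family_sets family_finite family_pos
  by unfold_locales (auto intro: finite_subset)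

lemma set_integrable_const: "R \<in> S \<Longrightarrow> set_integrable m R (\<lambda>x. c :: real)"
  using family_sets family_finite unfolding set_integrable_def by auto

lemma set_integrable_of_powr:
  fixes f :: "'a \<Rightarrow> real"
  assumes R: "R \<in> S" and p: "1 < p"
    and f: "f \<in> borel_measurable m" "\<And>x. 0 \<le> f x" "integrable m (\<lambda>x. f x powr p)"
  shows "set_integrable m R f"
  unfolding set_integrable_def
proof (rule Bochner_Integration.integrable_bound)
  have le1: "f x \<le> 1 + f x powr p" for x
  proof (cases "f x \<le> 1")
    case False
    then show ?thesis using powr_mono[of 1 p "f x"] p by simp
  qed (simp add: add_increasing2)
  show "integrable m (\<lambda>x. indicator R x + f x powr p)"
    using family_sets[OF R] family_finite[OF R] f(3) by (intro Bochner_Integration.integrable_add) auto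
  show "(\<lambda>x. indicator R x *\<^sub>R f x) \<in> borel_measurable m"
    using family_sets[OF R] f(1) by auto
  show "AE x in m. norm (indicator R x *\<^sub>R f x) \<le> norm (indicator R x + f x powr p)"
    using le1 f(2) by (auto simp: indicator_def)
qed

text \<open>
  The left-hand side is \<open>\<integral> (max\<^bsub>x \<in> R\<^esub> a\<^sub>R)\<^bsup>p\<^esup> dm\<close>, so this is the \<open>L\<^bsup>p\<^esup>\<close> bound of the maximal function of
  the family.  At a cube with a nonzero jump the maximum is the average \<open>a\<^sub>R\<close> of that very cube, so
  \<open>powr_diff_le_conjugate\<close> turns \<open>m(R)\<close> into the integral of \<open>f\<close> over \<open>R\<close>.  Summing the jumps
  back up gives \<open>\<integral> f (max\<^bsub>x \<in> R\<^esub> a\<^sub>R)\<^bsup>p-1\<^esup> dm\<close>.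
\<close>

lemma maximal_inequality:
  fixes f :: "'a \<Rightarrow> real"
  assumes p: "1 < p"
    and f: "f \<in> borel_measurable m" "\<And>x. 0 \<le> f x" "integrable m (\<lambda>x. f x powr p)"
  defines "a \<equiv> \<lambda>R. (LINT x:R|m. f x) / measure m R"
  shows "(\<Sum>R\<in>S. jump (fam_max (\<lambda>R. a R powr p)) S R * measure m R)
      \<le> 2 * (p / (p - 1)) * ((p - 1) / (2 * p)) powr (1 - p) * (LINT x|m. f x powr p)"
proof -
  note S = finite_family laminar_family
  note meas = family_sets family_finite family_pos
  have fint: "set_integrable m R f" if R: "R \<in> S" for R
    using set_integrable_of_powr[OF R p f] .
  have one_int: "set_integrable m R (\<lambda>x. 1 :: real)" if "R \<in> S" for R
    using set_integrable_const[OF that] .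
  have a0: "0 \<le> a R" for R
    unfolding a_def set_lebesgue_integral_def using f(2) by (intro divide_nonneg_nonneg integral_nonneg) auto
  have LINT: "(LINT x:R|m. f x) = a R * measure m R" if "R \<in> S" for R
    using meas(3)[OF that] by (simp add: a_def)
  let ?G = "\<lambda>q C. fam_max a C powr q"
  let ?c = "p / (p - 1)"
  let ?M = "\<lambda>x. fam_max a {R\<in>S. x \<in> R}"
  have powr_eq: "jump (fam_max (\<lambda>R. a R powr p)) S R = jump (?G p) S R" for R
    unfolding jump_def using S a0 p by (simp add: fam_max_powr)
  have jump: "jump (?G p) S R * measure m R \<le> ?c * (jump (?G (p - 1)) S R * (LINT x:R|m. f x))"
    if R: "R \<in> S" for R
  proof -
    let ?x = "fam_max a {P\<in>S. R \<subseteq> P}" and ?y = "fam_max a {P\<in>S. R \<subset> P}"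
    have xy: "?x = max (a R) ?y" "0 \<le> ?y"
      using fam_max_above[OF S(1) R] S(1) by (auto intro: fam_max_nonneg)
    show ?thesis
    proof (cases "a R \<le> ?y")
      case True
      then have "?x = ?y" using xy by simp
      then show ?thesis by (simp add: jump_def)
    next
      case False
      then have x: "?x = a R" using xy by simp
      have "jump (?G p) S R \<le> ?c * jump (?G (p - 1)) S R * a R"
        unfolding jump_def x using powr_diff_le_conjugate[OF p, of ?y "a R"] False xy by simp
      then have "jump (?G p) S R * measure m R \<le> ?c * jump (?G (p - 1)) S R * a R * measure m R"
        by (rule mult_right_mono) simp
      then show ?thesis using LINT[OF R] by (simp add: mult_ac)
    qed
  qed
  have Gp: "(\<Sum>R\<in>S. jump (?G p) S R * measure m R) = (LINT x|m. ?M x powr p)"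
    "integrable m (\<lambda>x. ?M x powr p)"
    using sum_jump_integral[OF S, of "?G p" m "\<lambda>_. 1"] integrable_on_family[OF S, of "?G p" m "\<lambda>_. 1"]
      one_int p meas by (simp_all add: set_lebesgue_integral_def)
  have Gq: "(\<Sum>R\<in>S. jump (?G (p - 1)) S R * (LINT x:R|m. f x)) = (LINT x|m. ?M x powr (p - 1) * f x)"
    "integrable m (\<lambda>x. ?M x powr (p - 1) * f x)"
    using sum_jump_integral[OF S, of "?G (p - 1)" m f] integrable_on_family[OF S, of "?G (p - 1)" m f]
      fint p by simp_all
  \<comment> \<open>Chosen so that the absorbed term has the coefficient \<open>1/2\<close>.\<close>
  let ?\<delta> = "(p - 1) / (2 * p)"
  have "(LINT x|m. ?M x powr (p - 1) * f x)
      \<le> (LINT x|m. ?\<delta> * ?M x powr p + ?\<delta> powr (1 - p) * f x powr p)"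
  proof (intro integral_mono Gq Bochner_Integration.integrable_add integrable_mult_right Gp(2) f(3))
    fix x
    show "?M x powr (p - 1) * f x \<le> ?\<delta> * ?M x powr p + ?\<delta> powr (1 - p) * f x powr p"
      using mult_powr_le_add[OF p f(2)[of x], of "?M x" ?\<delta>] fam_max_nonneg[of "{R\<in>S. x \<in> R}" a] S(1) p
      by (simp add: mult.commute)
  qed
  also have "\<dots> = ?\<delta> * (LINT x|m. ?M x powr p) + ?\<delta> powr (1 - p) * (LINT x|m. f x powr p)"
    using Gp(2) f(3) by simp
  finally have absorb: "(LINT x|m. ?M x powr (p - 1) * f x)
      \<le> ?\<delta> * (LINT x|m. ?M x powr p) + ?\<delta> powr (1 - p) * (LINT x|m. f x powr p)" .
  have "(LINT x|m. ?M x powr p) \<le> ?c * (LINT x|m. ?M x powr (p - 1) * f x)"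
    unfolding Gp(1)[symmetric] Gq(1)[symmetric] sum_distrib_left by (intro sum_mono jump)
  also have "\<dots> \<le> ?c * (?\<delta> * (LINT x|m. ?M x powr p) + ?\<delta> powr (1 - p) * (LINT x|m. f x powr p))"
    using absorb p by (intro mult_left_mono) auto
  also have "\<dots> = (?c * ?\<delta>) * (LINT x|m. ?M x powr p) + ?c * ?\<delta> powr (1 - p) * (LINT x|m. f x powr p)"
    by (simp only: distrib_left mult.assoc)
  also have "?c * ?\<delta> = 1 / 2" using p by (simp add: field_simps)
  finally show ?thesis unfolding powr_eq Gp(1) by linarith
qed

text \<open>
  Kolmogorov's inequality in packing form.  Put \<open>a\<^sub>Q = m(Q)/L(Q)\<close>.  Below a fixed \<open>R\<close>, a nonzero jump of the power \<open>\<alpha>\<close> of the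
  maximal average occurs only where the average is new, and there \<open>powr_diff_le_negative_power\<close> turns
  \<open>L\<close> into \<open>m\<close> at the price of a decrease of the power \<open>\<alpha> - 1\<close>.  These decreases telescope to at most
  \<open>a\<^sub>R\<^bsup>\<alpha>-1\<^esup>\<close>, and \<open>a\<^sub>R\<^bsup>\<alpha>-1\<^esup> m(R) = a\<^sub>R\<^bsup>\<alpha>\<^esup> L(R)\<close>.
\<close>

lemma packing_powr_average:
  assumes L: "\<And>R. R \<in> S \<Longrightarrow> 0 < L R" "packing K S L" "0 \<le> K"
    and \<alpha>: "0 \<le> \<alpha>" "\<alpha> < 1"
  shows "packing (K / (1 - \<alpha>)) S (\<lambda>Q. (measure m Q / L Q) powr \<alpha> * L Q)"
  unfolding packing_def
proof
  note S = finite_family laminar_family empty_notin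
  note meas = family_sets family_finite family_pos
  fix R assume R: "R \<in> S"
  define a where "a Q = measure m Q / L Q" for Q
  define T where "T = {Q\<in>S. Q \<subseteq> R}"
  have T: "finite T" "laminar T" "{} \<notin> T" "R \<in> T" "\<And>Q. Q \<in> T \<Longrightarrow> Q \<in> S"
    using S R laminar_subset[of S T] by (auto simp: T_def)
  have a: "0 < a Q" "measure m Q = a Q * L Q" if "Q \<in> T" for Q
    using L(1)[of Q] meas(3)[of Q] T(5)[OF that] by (auto simp: a_def)
  have packT: "packing K T L"
    unfolding packing_def
  proof
    fix P assume P: "P \<in> T"
    then have "{Q \<in> T. Q \<subseteq> P} = {Q \<in> S. Q \<subseteq> P}" by (auto simp: T_def)
    then show "(\<Sum>Q | Q \<in> T \<and> Q \<subseteq> P. L Q) \<le> K * L P"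
      using L(2) T(5)[OF P] by (simp add: packing_def)
  qed
  let ?F = "\<lambda>C. if C = {} then 0 else fam_max a C powr \<alpha>"
  \<comment> \<open>Normalised so that the jump at the top cube vanishes; the jump of \<open>?F\<close> there is
    \<open>a\<^sub>R\<^bsup>\<alpha>\<^esup>\<close> and is treated separately.\<close>
  let ?G = "\<lambda>C. if C = {} then 0 else a R powr (\<alpha> - 1) - fam_max a C powr (\<alpha> - 1)"
  let ?c = "\<alpha> / (1 - \<alpha>)"
  have up_ne: "{P\<in>T. Q \<subseteq> P} \<noteq> {}" if "Q \<in> T" for Q using that by blast
  have topR: "{P\<in>T. R \<subseteq> P} = {R}" "{P\<in>T. R \<subset> P} = {}"
    using R by (auto simp: T_def)
  have jumpR: "jump ?F T R = a R powr \<alpha>" "jump ?G T R = 0"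
    using a(1)[OF T(4)] unfolding jump_def topR by (simp_all add: fam_max_insert)
  have jump: "0 \<le> jump ?F T Q \<and> jump ?F T Q * L Q \<le> ?c * (jump ?G T Q * measure m Q)"
    if Q: "Q \<in> T" "Q \<noteq> R" for Q
  proof -
    let ?x = "fam_max a {P\<in>T. Q \<subseteq> P}" and ?y = "fam_max a {P\<in>T. Q \<subset> P}"
    have RQ: "R \<in> {P\<in>T. Q \<subset> P}" using Q T(4) by (auto simp: T_def)
    then have y: "0 < ?y"
      using fam_max_upper[of "{P\<in>T. Q \<subset> P}" R a] T(1) a(1)[OF T(4)] by simp
    have x: "?x = max (a Q) ?y" using fam_max_above[OF T(1) Q(1)] .
    have F: "jump ?F T Q = ?x powr \<alpha> - ?y powr \<alpha>"
      and G: "jump ?G T Q = ?y powr (\<alpha> - 1) - ?x powr (\<alpha> - 1)"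
      using RQ up_ne[OF Q(1)] unfolding jump_def by auto
    show ?thesis
    proof (cases "a Q \<le> ?y")
      case True
      then have "?x = ?y" using x by simp
      then show ?thesis unfolding F G by simp
    next
      case False
      then have xQ: "?x = a Q" using x by simp
      have "jump ?F T Q \<le> ?c * jump ?G T Q * a Q"
        unfolding F G xQ using powr_diff_le_negative_power[OF \<alpha> y, of "a Q"] False by simp
      then have "jump ?F T Q * L Q \<le> ?c * jump ?G T Q * a Q * L Q"
        using L(1)[OF T(5)[OF Q(1)]] by (intro mult_right_mono) auto
      moreover have "0 \<le> jump ?F T Q"
        unfolding F xQ using False y \<alpha> by (simp add: powr_mono2)
      ultimately show ?thesis using a(2)[OF Q(1)] by (simp add: mult_ac)
    qed
  qed
  have one_int: "set_integrable m Q (\<lambda>x. 1 :: real)" if "Q \<in> T" for Q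
    using set_integrable_const[OF T(5)[OF that]] .
  have G_le: "?G {Q\<in>T. x \<in> Q} \<le> a R powr (\<alpha> - 1) * indicator R x" for x
  proof (cases "{Q\<in>T. x \<in> Q} = {}")
    case False
    then have "x \<in> R" by (auto simp: T_def)
    then show ?thesis using False by simp
  next
    case True
    then show ?thesis by simp
  qed
  have intR: "integrable m (\<lambda>x. a R powr (\<alpha> - 1) * indicator R x)"
    using one_int[OF T(4)] unfolding set_integrable_def by simp
  have "(\<Sum>Q\<in>T. jump ?G T Q * measure m Q) = (LINT x|m. ?G {Q\<in>T. x \<in> Q} * 1)"
    using sum_jump_integral[OF T(1,2), of ?G m "\<lambda>_. 1"] one_int meas T(5) 
    by (simp add: set_lebesgue_integral_def)
  also have "\<dots> \<le> (LINT x|m. a R powr (\<alpha> - 1) * indicator R x)"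
    using integrable_on_family[OF T(1,2), of ?G m "\<lambda>_. 1"] one_int G_le intR
    by (intro integral_mono) auto
  also have "\<dots> = a R powr (\<alpha> - 1) * measure m R"
    using meas[OF R] by simp
  also have "\<dots> = a R powr \<alpha> * L R"
    using a[OF T(4)] powr_mult_base[of "a R" "\<alpha> - 1"] by (simp add: mult_ac)
  finally have G_sum: "(\<Sum>Q\<in>T. jump ?G T Q * measure m Q) \<le> a R powr \<alpha> * L R" .
  have "(\<Sum>Q\<in>T. a Q powr \<alpha> * L Q) \<le> (\<Sum>Q\<in>T. ?F {P\<in>T. Q \<subseteq> P} * L Q)"
  proof (intro sum_mono mult_right_mono)
    fix Q assume Q: "Q \<in> T"
    show "a Q powr \<alpha> \<le> ?F {P\<in>T. Q \<subseteq> P}"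
      using up_ne[OF Q] a(1)[OF Q] fam_max_upper[of "{P\<in>T. Q \<subseteq> P}" Q a] Q T(1) \<alpha>
      by (auto intro!: powr_mono2)
    show "0 \<le> L Q" using L(1)[OF T(5)[OF Q]] by simp
  qed
  also have "\<dots> \<le> K * (\<Sum>Q\<in>T. jump ?F T Q * L Q)"
  proof (rule sum_le_sum_jump[OF T(1-3) _ _ packT])
    show "0 \<le> jump ?F T Q" if "Q \<in> T" for Q
      using jump[OF that] jumpR by (cases "Q = R") auto
  qed simp
  also have "(\<Sum>Q\<in>T. jump ?F T Q * L Q) = a R powr \<alpha> * L R + (\<Sum>Q\<in>T - {R}. jump ?F T Q * L Q)"
    using sum.remove[OF T(1,4), of "\<lambda>Q. jump ?F T Q * L Q"] unfolding jumpR by simp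
  also have "(\<Sum>Q\<in>T - {R}. jump ?F T Q * L Q) \<le> (\<Sum>Q\<in>T - {R}. ?c * (jump ?G T Q * measure m Q))"
    using jump by (intro sum_mono) auto
  also have "\<dots> = ?c * (\<Sum>Q\<in>T. jump ?G T Q * measure m Q)"
    using sum.remove[OF T(1,4), of "\<lambda>Q. jump ?G T Q * measure m Q"] unfolding jumpR
    by (simp add: sum_distrib_left)
  also have "\<dots> \<le> ?c * (a R powr \<alpha> * L R)"
    using G_sum \<alpha> by (intro mult_left_mono) auto
  finally have "(\<Sum>Q\<in>T. a Q powr \<alpha> * L Q) \<le> K * (a R powr \<alpha> * L R + ?c * (a R powr \<alpha> * L R))"
    using L(3) by (simp add: mult_left_mono)
  also have "\<dots> = (K * (1 + ?c)) * (a R powr \<alpha> * L R)"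
    by (simp add: algebra_simps)
  also have "K * (1 + ?c) = K / (1 - \<alpha>)" using \<alpha> by (simp add: field_simps)
  finally show "(\<Sum>Q | Q \<in> S \<and> Q \<subseteq> R. (measure m Q / L Q) powr \<alpha> * L Q)
      \<le> K / (1 - \<alpha>) * ((measure m R / L R) powr \<alpha> * L R)"
    by (simp add: T_def a_def)
qed

end

section \<open>Two weights\<close>

text \<open>
  The product rule, followed by the subadditivity of fractional powers: each term contains the jump of
  one factor, inside the power, and the current value of the other.
\<close>

lemma jump_powr_mult_le:
  assumes S: "finite S" "R \<in> S" and t: "0 < t" "t < 1"
  shows "jump (\<lambda>C. fam_max u C powr t * fam_max y C powr (1 - t)) S R
    \<le> jump (fam_max u) S R powr t * fam_max y {P\<in>S. R \<subseteq> P} powr (1 - t)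
      + fam_max u {P\<in>S. R \<subseteq> P} powr t * jump (fam_max y) S R powr (1 - t)"
proof -
  define U U' Y Y' where "U = fam_max u {P\<in>S. R \<subseteq> P}" "U' = fam_max u {P\<in>S. R \<subset> P}"
    "Y = fam_max y {P\<in>S. R \<subseteq> P}" "Y' = fam_max y {P\<in>S. R \<subset> P}"
  have *: "0 \<le> U'" "U' \<le> U" "0 \<le> Y'" "Y' \<le> Y"
    unfolding U_U'_Y_Y'_def using S(1) by (auto intro!: fam_max_nonneg fam_max_mono)
  have "U powr t * Y powr (1 - t) - U' powr t * Y' powr (1 - t)
      = (U powr t - U' powr t) * Y powr (1 - t) + U' powr t * (Y powr (1 - t) - Y' powr (1 - t))"
    by (simp add: algebra_simps)
  also have "\<dots> \<le> (U - U') powr t * Y powr (1 - t) + U powr t * (Y - Y') powr (1 - t)"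
    using * t by (intro add_mono mult_mono powr_diff_le powr_mono2) (auto intro: powr_mono2)
  finally show ?thesis by (simp add: jump_def U_U'_Y_Y'_def)
qed

text \<open>
  The first summation by parts uses the packing of \<open>\<mu>\<close>, and only afterwards is \<open>\<mu>\<close> replaced by
  \<open>s\<^bsup>t\<^esup> v\<^bsup>1-t\<^esup>\<close>.  In each of the two terms of the product rule, Hoelder's inequality leaves a sum of jumps,
  which is \<open>U\<close> or \<open>Y\<close> with no loss, and a sum of values, which a second summation by parts reduces to
  jumps at the cost of \<open>Kv\<close> or \<open>Ks\<close>.
\<close>

lemma bilinear_packing_bound:
  assumes S: "finite S" "laminar S" "{} \<notin> S" and t: "0 < t" "t < 1"
    and nonneg: "\<And>Q. Q \<in> S \<Longrightarrow> 0 \<le> u Q" "\<And>Q. Q \<in> S \<Longrightarrow> 0 \<le> y Q"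
      "\<And>Q. Q \<in> S \<Longrightarrow> 0 \<le> s Q" "\<And>Q. Q \<in> S \<Longrightarrow> 0 \<le> v Q" "\<And>Q. Q \<in> S \<Longrightarrow> 0 \<le> \<mu> Q"
    and pack: "packing K S \<mu>" "packing Ks S s" "packing Kv S v"
    and K: "0 \<le> K" "0 \<le> Ks" "0 \<le> Kv" "0 \<le> B"
    and \<mu>: "\<And>Q. Q \<in> S \<Longrightarrow> \<mu> Q \<le> B * (s Q powr t * v Q powr (1 - t))"
  defines "U \<equiv> \<Sum>R\<in>S. jump (fam_max u) S R * s R"
    and "Y \<equiv> \<Sum>R\<in>S. jump (fam_max y) S R * v R"
  shows "(\<Sum>Q\<in>S. u Q powr t * y Q powr (1 - t) * \<mu> Q)
    \<le> K * B * (Kv powr (1 - t) + Ks powr t) * (U powr t * Y powr (1 - t))"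
proof -
  let ?F = "\<lambda>C. fam_max u C powr t * fam_max y C powr (1 - t)"
  define Up Yp where "Up Q = fam_max u {P\<in>S. Q \<subseteq> P}" and "Yp Q = fam_max y {P\<in>S. Q \<subseteq> P}" for Q
  define du dy where "du Q = jump (fam_max u) S Q" and "dy Q = jump (fam_max y) S Q" for Q
  have p0: "0 \<le> Up Q" "0 \<le> Yp Q" "0 \<le> du Q" "0 \<le> dy Q" for Q
    unfolding Up_def Yp_def du_def dy_def using S(1) by (auto intro: fam_max_nonneg jump_fam_max_nonneg)
  have le_p: "u Q \<le> Up Q" "y Q \<le> Yp Q" if "Q \<in> S" for Q
    unfolding Up_def Yp_def using S(1) that by (auto intro: fam_max_upper)
  have U0: "0 \<le> U" "0 \<le> Y"
    unfolding U_def Y_def using p0 nonneg by (auto intro!: sum_nonneg mult_nonneg_nonneg simp: du_def dy_def)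
  have jumpF: "0 \<le> jump ?F S R" for R
    unfolding jump_def using S(1) t
    by (auto intro!: mult_mono powr_mono2 fam_max_mono fam_max_nonneg)
  have Up_sum: "(\<Sum>Q\<in>S. Up Q * s Q) \<le> Ks * U"
    unfolding U_def Up_def by (rule sum_le_sum_jump[OF S _ jump_fam_max_nonneg[OF S(1)] pack(2)]) simp
  have Yp_sum: "(\<Sum>Q\<in>S. Yp Q * v Q) \<le> Kv * Y"
    unfolding Y_def Yp_def by (rule sum_le_sum_jump[OF S _ jump_fam_max_nonneg[OF S(1)] pack(3)]) simp
  have Holder_le: "(\<Sum>Q\<in>S. (c Q powr t * d Q powr (1 - t)) * (s Q powr t * v Q powr (1 - t)))
      \<le> C powr t * D powr (1 - t)"
    if "\<And>Q. 0 \<le> c Q" "\<And>Q. 0 \<le> d Q" "(\<Sum>Q\<in>S. c Q * s Q) \<le> C" "(\<Sum>Q\<in>S. d Q * v Q) \<le> D" for c d C D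
  proof -
    have "(\<Sum>Q\<in>S. (c Q powr t * d Q powr (1 - t)) * (s Q powr t * v Q powr (1 - t)))
        = (\<Sum>Q\<in>S. (c Q * s Q) powr t * (d Q * v Q) powr (1 - t))"
      using nonneg that by (intro sum.cong) (simp_all add: powr_mult)
    also have "\<dots> \<le> (\<Sum>Q\<in>S. c Q * s Q) powr t * (\<Sum>Q\<in>S. d Q * v Q) powr (1 - t)"
      using nonneg that by (intro Holder_sum t mult_nonneg_nonneg)
    also have "\<dots> \<le> C powr t * D powr (1 - t)"
      using t that nonneg by (intro mult_mono powr_mono2 sum_nonneg mult_nonneg_nonneg) auto
    finally show ?thesis .
  qed
  have "(\<Sum>R\<in>S. jump ?F S R * \<mu> R)
      \<le> (\<Sum>R\<in>S. (du R powr t * Yp R powr (1 - t) + Up R powr t * dy R powr (1 - t))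
              * (B * (s R powr t * v R powr (1 - t))))"
    using jump_powr_mult_le[OF S(1) _ t, of _ u y] \<mu> nonneg jumpF p0 
    by (intro sum_mono mult_mono) (auto simp: du_def dy_def Up_def Yp_def)
  also have "\<dots> = B * ((\<Sum>R\<in>S. (du R powr t * Yp R powr (1 - t)) * (s R powr t * v R powr (1 - t)))
      + (\<Sum>R\<in>S. (Up R powr t * dy R powr (1 - t)) * (s R powr t * v R powr (1 - t))))"
    by (simp add: sum_distrib_left sum.distrib algebra_simps)
  also have "\<dots> \<le> B * (U powr t * (Kv * Y) powr (1 - t) + (Ks * U) powr t * Y powr (1 - t))"
    using p0 Up_sum Yp_sum K
    by (intro mult_left_mono add_mono Holder_le) (auto simp: U_def Y_def du_def dy_def)
  also have "\<dots> = B * ((Kv powr (1 - t) + Ks powr t) * (U powr t * Y powr (1 - t)))"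
    using K U0 by (simp add: powr_mult algebra_simps)
  finally have jumps: "(\<Sum>R\<in>S. jump ?F S R * \<mu> R)
      \<le> B * ((Kv powr (1 - t) + Ks powr t) * (U powr t * Y powr (1 - t)))" .
  have "(\<Sum>Q\<in>S. u Q powr t * y Q powr (1 - t) * \<mu> Q) \<le> (\<Sum>Q\<in>S. ?F {P\<in>S. Q \<subseteq> P} * \<mu> Q)"
    using nonneg le_p t by (intro sum_mono mult_mono powr_mono2) (auto simp: Up_def Yp_def)
  also have "\<dots> \<le> K * (\<Sum>R\<in>S. jump ?F S R * \<mu> R)"
    by (rule sum_le_sum_jump[OF S _ jumpF pack(1)]) simp
  also have "\<dots> \<le> K * (B * ((Kv powr (1 - t) + Ks powr t) * (U powr t * Y powr (1 - t))))"
    using jumps K(1) by (rule mult_left_mono)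
  finally show ?thesis by (simp only: mult.assoc)
qed

lemma packing_subset:
  assumes "packing K S m" "T \<subseteq> S" "finite S" "\<And>Q. Q \<in> S \<Longrightarrow> 0 \<le> m Q"
  shows "packing K T m"
  unfolding packing_def
proof
  fix R assume R: "R \<in> T"
  have "(\<Sum>Q | Q \<in> T \<and> Q \<subseteq> R. m Q) \<le> (\<Sum>Q | Q \<in> S \<and> Q \<subseteq> R. m Q)"
    using assms by (intro sum_mono2) auto
  also have "\<dots> \<le> K * m R" using assms(1,2) R by (auto simp: packing_def)
  finally show "(\<Sum>Q | Q \<in> T \<and> Q \<subseteq> R. m Q) \<le> K * m R" .
qed

text \<open>
  A factor that varies by at most \<open>2\<close> over the family can be taken out of the packing sums.
\<close>

lemma packing_comparable_factor:
  assumes pack: "packing K S e" and e: "\<And>Q. Q \<in> S \<Longrightarrow> 0 \<le> e Q"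
    and l: "\<And>Q. Q \<in> S \<Longrightarrow> A / 2 < l Q \<and> l Q \<le> A" and t: "0 < t" "t \<le> 1" "0 < A" "0 \<le> K"
  shows "packing (2 * K) S (\<lambda>Q. l Q powr t * e Q)"
  unfolding packing_def
proof
  fix R assume R: "R \<in> S"
  have l0: "0 < l Q" if "Q \<in> S" for Q using l[OF that] t by simp
  have "(\<Sum>Q | Q \<in> S \<and> Q \<subseteq> R. l Q powr t * e Q) \<le> (\<Sum>Q | Q \<in> S \<and> Q \<subseteq> R. A powr t * e Q)"
    using l l0 e t by (intro sum_mono mult_right_mono powr_mono2) (auto intro: less_imp_le)
  also have "\<dots> = A powr t * (\<Sum>Q | Q \<in> S \<and> Q \<subseteq> R. e Q)" by (simp add: sum_distrib_left)
  also have "\<dots> \<le> A powr t * (K * e R)"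
    using pack R by (intro mult_left_mono) (auto simp: packing_def)
  also have "A powr t \<le> 2 * l R powr t"
  proof -
    have "A powr t \<le> (2 * l R) powr t" using l[OF R] t by (intro powr_mono2) auto
    also have "\<dots> = 2 powr t * l R powr t" using l0[OF R] by (simp add: powr_mult)
    also have "\<dots> \<le> 2 powr 1 * l R powr t" using t by (intro mult_right_mono powr_mono) auto
    finally show ?thesis by simp
  qed
  finally show "(\<Sum>Q | Q \<in> S \<and> Q \<subseteq> R. l Q powr t * e Q) \<le> 2 * K * (l R powr t * e R)"
    using t(4) e[OF R] by (simp add: mult_right_mono mult_ac)
qed

text \<open>
  This is \<open>1 - \<alpha>\<close> for the exponent \<open>\<alpha>\<close> to which \<open>packing_powr_average\<close> is applied in
  \<open>slice_packing\<close> below.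
\<close>

definition exponent_gap :: "real \<Rightarrow> real \<Rightarrow> real" where
  "exponent_gap p r = (if p - 1 \<le> r then p - r else r / (p - 1))"

lemma exponent_gap_pos: "1 < p \<Longrightarrow> 0 < r \<Longrightarrow> r < p \<Longrightarrow> 0 < exponent_gap p r"
  by (simp add: exponent_gap_def)

definition maximal_const :: "real \<Rightarrow> real" where
  "maximal_const p = 2 * (p / (p - 1)) * ((p - 1) / (2 * p)) powr (1 - p)"

lemma maximal_const_pos: "1 < p \<Longrightarrow> 0 < maximal_const p"
  by (simp add: maximal_const_def)

text \<open>
  Here \<open>ms\<close>, \<open>mw\<close> and \<open>L\<close> stand for \<open>\<sigma> dx\<close>, \<open>w dx\<close> and Lebesgue measure.  The packing constant of
  \<open>mw\<close> is not a parameter, because for \<open>r \<ge> p\<close> the bound depends on that of \<open>ms\<close> only.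
\<close>

locale two_weight_family = s: measured_family S ms + v: measured_family S mw
  for S :: "'a set set" and ms mw :: "'a measure" +
  fixes L :: "'a set \<Rightarrow> real" and \<Lambda> Ks :: real
  assumes L_pos: "Q \<in> S \<Longrightarrow> 0 < L Q"
    and L_packing: "packing \<Lambda> S L" and s_packing: "packing Ks S (measure ms)"
    and constants: "0 \<le> \<Lambda>" "0 \<le> Ks"
begin

definition avg_s :: "'a set \<Rightarrow> real" where "avg_s Q = measure ms Q / L Q"
definition avg_w :: "'a set \<Rightarrow> real" where "avg_w Q = measure mw Q / L Q"

lemma av_pos: "Q \<in> S \<Longrightarrow> 0 < avg_s Q" "Q \<in> S \<Longrightarrow> 0 < avg_w Q"
  using L_pos s.family_pos v.family_pos by (auto simp: avg_s_def avg_w_def)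

lemma two_weight_subfamily: "T \<subseteq> S \<Longrightarrow> two_weight_family T ms mw L \<Lambda> Ks"
  using s.subfamily v.subfamily L_pos constants
    packing_subset[OF L_packing _ s.finite_family] packing_subset[OF s_packing _ s.finite_family]
  by (simp add: two_weight_family_def two_weight_family_axioms_def less_imp_le subset_iff)

text \<open>
  With \<open>\<lambda>\<^sub>Q = \<langle>w\<rangle>\<^sub>Q \<langle>\<sigma>\<rangle>\<^sub>Q\<^bsup>p-1\<^esup>\<close>, the weight is \<open>\<lambda>\<^sub>Q \<langle>\<sigma>\<rangle>\<^sub>Q\<^bsup>r-p+1\<^esup> |Q|\<close>, and also
  \<open>\<lambda>\<^sub>Q\<^bsup>\<theta>\<^esup> \<langle>w\<rangle>\<^sub>Q\<^bsup>1-\<theta>\<^esup> |Q|\<close> for \<open>\<theta> = r/(p - 1)\<close>.  The first form is used when its exponent \<open>r - p + 1\<close> is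
  nonnegative, the second one otherwise.  The exponent of the average is below \<open>1\<close> in both cases, in the
  first one because \<open>r < p\<close>.
\<close>

lemma slice_packing:
  assumes p: "1 < p" "0 < r" "r < p" and A: "0 < A"
    and slice: "\<And>Q. Q \<in> S \<Longrightarrow> A / 2 < avg_w Q * avg_s Q powr (p - 1) \<and> avg_w Q * avg_s Q powr (p - 1) \<le> A"
  shows "packing (2 * (\<Lambda> / exponent_gap p r)) S (\<lambda>Q. avg_s Q powr r * measure mw Q)"
proof (cases "p - 1 \<le> r")
  case True
  have "packing (\<Lambda> / exponent_gap p r) S (\<lambda>Q. avg_s Q powr (r - p + 1) * L Q)"
    using s.packing_powr_average[OF L_pos L_packing constants(1), of "r - p + 1"] True p
    by (simp add: avg_s_def exponent_gap_def)
  then have "packing (2 * (\<Lambda> / exponent_gap p r)) S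
      (\<lambda>Q. (avg_w Q * avg_s Q powr (p - 1)) powr 1 * (avg_s Q powr (r - p + 1) * L Q))"
    using slice A L_pos constants exponent_gap_pos[OF p]
    by (intro packing_comparable_factor[where A = A]) (auto simp: less_imp_le)
  moreover have "(avg_w Q * avg_s Q powr (p - 1)) powr 1 * (avg_s Q powr (r - p + 1) * L Q)
      = avg_s Q powr r * measure mw Q" if "Q \<in> S" for Q
  proof -
    have "avg_s Q powr (p - 1) * avg_s Q powr (r - p + 1) = avg_s Q powr r"
      by (simp flip: powr_add)
    then show ?thesis
      using av_pos[OF that] L_pos[OF that] by (simp add: avg_w_def mult_ac)
  qed
  ultimately show ?thesis unfolding packing_def by simp
next
  case False
  let ?t = "r / (p - 1)"
  have t: "0 < ?t" "?t < 1" using False p by auto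
  have "packing (\<Lambda> / exponent_gap p r) S (\<lambda>Q. avg_w Q powr (1 - ?t) * L Q)"
    using v.packing_powr_average[OF L_pos L_packing constants(1), of "1 - ?t"] False t
    by (simp add: avg_w_def exponent_gap_def)
  then have "packing (2 * (\<Lambda> / exponent_gap p r)) S
      (\<lambda>Q. (avg_w Q * avg_s Q powr (p - 1)) powr ?t * (avg_w Q powr (1 - ?t) * L Q))"
    using slice A L_pos constants exponent_gap_pos[OF p] t
    by (intro packing_comparable_factor[where A = A]) (auto simp: less_imp_le)
  moreover have "(avg_w Q * avg_s Q powr (p - 1)) powr ?t * (avg_w Q powr (1 - ?t) * L Q)
      = avg_s Q powr r * measure mw Q" if "Q \<in> S" for Q
  proof -
    have "avg_w Q powr ?t * avg_w Q powr (1 - ?t) = avg_w Q"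
      using av_pos[OF that] by (simp flip: powr_add)
    then have "avg_w Q powr ?t * (avg_w Q powr (1 - ?t) * L Q) = measure mw Q"
      using L_pos[OF that] by (simp add: avg_w_def mult.assoc[symmetric])
    moreover have "(avg_w Q * avg_s Q powr (p - 1)) powr ?t = avg_w Q powr ?t * avg_s Q powr r"
      using av_pos[OF that] p by (simp add: powr_mult powr_powr)
    ultimately show ?thesis by (simp add: mult_ac)
  qed
  ultimately show ?thesis unfolding packing_def by simp
qed

text \<open>
  The bilinear packing estimate with \<open>u = a\<^bsup>p\<^esup>\<close> and \<open>y = b\<^bsup>p/(p-r)\<^esup>\<close>; the sums of jumps are then bounded
  by the maximal inequality for either weight.
\<close>

lemma slice_bound:
  fixes f g :: "'a \<Rightarrow> real"
  assumes p: "1 < p" "0 < r" "r < p" and A: "0 < A"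
    and slice: "\<And>Q. Q \<in> S \<Longrightarrow> A / 2 < avg_w Q * avg_s Q powr (p - 1) \<and> avg_w Q * avg_s Q powr (p - 1) \<le> A"
    and f: "f \<in> borel_measurable ms" "\<And>x. 0 \<le> f x" "integrable ms (\<lambda>x. f x powr p)"
    and g: "g \<in> borel_measurable mw" "\<And>x. 0 \<le> g x" "integrable mw (\<lambda>x. g x powr (p / (p - r)))"
    and v: "packing Kv S (measure mw)" "0 \<le> Kv"
  defines "a \<equiv> \<lambda>Q. (LINT x:Q|ms. f x) / measure ms Q"
    and "b \<equiv> \<lambda>Q. (LINT x:Q|mw. g x) / measure mw Q"
  shows "(\<Sum>Q\<in>S. a Q powr r * b Q * (avg_s Q powr r * measure mw Q))
    \<le> 2 * (\<Lambda> / exponent_gap p r) * maximal_const p powr (r / p) * maximal_const (p / (p - r)) powr (1 - r / p)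
        * (Kv powr (1 - r / p) + Ks powr (r / p))
        * ((LINT x|ms. f x powr p) powr (r / p) * (LINT x|mw. g x powr (p / (p - r))) powr (1 - r / p))
        * A powr (r / p)"
proof -
  let ?t = "r / p" and ?q = "p / (p - r)"
  have t: "0 < ?t" "?t < 1" and q: "1 < ?q" and qt: "?q * (1 - ?t) = 1" and pt: "p * ?t = r"
    using p by (auto simp: field_simps)
  note S = s.finite_family s.laminar_family s.empty_notin
  have a0: "0 \<le> a Q" and b0: "0 \<le> b Q" for Q
    unfolding a_def b_def set_lebesgue_integral_def using f(2) g(2)
    by (auto intro!: divide_nonneg_nonneg integral_nonneg)
  let ?U = "\<Sum>R\<in>S. jump (fam_max (\<lambda>Q. a Q powr p)) S R * measure ms R"
  let ?Y = "\<Sum>R\<in>S. jump (fam_max (\<lambda>Q. b Q powr ?q)) S R * measure mw R"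
  have U: "?U \<le> maximal_const p * (LINT x|ms. f x powr p)"
    using s.maximal_inequality[OF p(1) f] by (simp add: a_def maximal_const_def)
  have Y: "?Y \<le> maximal_const ?q * (LINT x|mw. g x powr ?q)"
    using v.maximal_inequality[OF q g] by (simp add: b_def maximal_const_def)
  have UY0: "0 \<le> ?U" "0 \<le> ?Y"
    using jump_fam_max_nonneg[OF S(1)] by (auto intro!: sum_nonneg)
  have weight_eq: "avg_s Q powr r * measure mw Q
      \<le> A powr ?t * (measure ms Q powr ?t * measure mw Q powr (1 - ?t))" if Q: "Q \<in> S" for Q
  proof -
    have "measure ms Q powr ?t * measure mw Q powr (1 - ?t)
        = avg_s Q powr ?t * avg_w Q powr (1 - ?t) * (L Q powr ?t * L Q powr (1 - ?t))"
      using L_pos[OF Q] by (simp add: avg_s_def avg_w_def powr_divide)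
    also have "L Q powr ?t * L Q powr (1 - ?t) = L Q"
      using L_pos[OF Q] by (simp flip: powr_add)
    finally have 1: "measure ms Q powr ?t * measure mw Q powr (1 - ?t)
        = avg_s Q powr ?t * avg_w Q powr (1 - ?t) * L Q" .
    have "(avg_w Q * avg_s Q powr (p - 1)) powr ?t * (avg_s Q powr ?t * avg_w Q powr (1 - ?t) * L Q)
        = (avg_w Q powr ?t * avg_w Q powr (1 - ?t)) * (avg_s Q powr ((p - 1) * ?t) * avg_s Q powr ?t) * L Q"
      using av_pos[OF Q] by (simp add: powr_mult powr_powr)
    also have "avg_w Q powr ?t * avg_w Q powr (1 - ?t) = avg_w Q"
      using av_pos[OF Q] by (simp flip: powr_add)
    also have "avg_s Q powr ((p - 1) * ?t) * avg_s Q powr ?t = avg_s Q powr r"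
      using p by (simp add: field_simps flip: powr_add)
    also have "avg_w Q * avg_s Q powr r * L Q = avg_s Q powr r * measure mw Q"
      using L_pos[OF Q] by (simp add: avg_w_def)
    finally have "avg_s Q powr r * measure mw Q
        = (avg_w Q * avg_s Q powr (p - 1)) powr ?t * (measure ms Q powr ?t * measure mw Q powr (1 - ?t))"
      unfolding 1 by simp
    also have "\<dots> \<le> A powr ?t * (measure ms Q powr ?t * measure mw Q powr (1 - ?t))"
      using slice[OF Q] av_pos[OF Q] t by (intro mult_right_mono powr_mono2) auto
    finally show ?thesis .
  qed
  have "(\<Sum>Q\<in>S. a Q powr r * b Q * (avg_s Q powr r * measure mw Q))
      = (\<Sum>Q\<in>S. (a Q powr p) powr ?t * (b Q powr ?q) powr (1 - ?t) * (avg_s Q powr r * measure mw Q))"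
    using b0 by (simp only: powr_powr pt qt powr_one)
  also have "\<dots> \<le> 2 * (\<Lambda> / exponent_gap p r) * (A powr ?t) * (Kv powr (1 - ?t) + Ks powr ?t)
      * (?U powr ?t * ?Y powr (1 - ?t))"
    using av_pos exponent_gap_pos[OF p] constants v(2)
    by (intro bilinear_packing_bound[OF S t] slice_packing[OF p A slice] s_packing v(1) weight_eq)
      (auto simp: less_imp_le)
  also have "\<dots> \<le> 2 * (\<Lambda> / exponent_gap p r) * (A powr ?t) * (Kv powr (1 - ?t) + Ks powr ?t)
      * ((maximal_const p * (LINT x|ms. f x powr p)) powr ?t
        * (maximal_const ?q * (LINT x|mw. g x powr ?q)) powr (1 - ?t))"
    using constants v(2) exponent_gap_pos[OF p] t UY0
    by (intro mult_left_mono mult_mono powr_mono2 U Y) auto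
  also have "\<dots> = 2 * (\<Lambda> / exponent_gap p r) * (A powr ?t) * (Kv powr (1 - ?t) + Ks powr ?t)
      * ((maximal_const p powr ?t * (LINT x|ms. f x powr p) powr ?t)
        * (maximal_const ?q powr (1 - ?t) * (LINT x|mw. g x powr ?q) powr (1 - ?t)))"
    using maximal_const_pos[OF p(1)] maximal_const_pos[OF q] by (simp add: powr_mult)
  finally show ?thesis by (simp only: mult_ac)
qed

text \<open>
  The factor \<open>A\<^bsup>r/p\<^esup>\<close> in \<open>slice_bound\<close> decays geometrically over the dyadic slices.
\<close>

lemma bilinear_bound:
  fixes f g :: "'a \<Rightarrow> real"
  assumes p: "1 < p" "0 < r" "r < p" and A: "0 < A"
    and Ap: "\<And>Q. Q \<in> S \<Longrightarrow> avg_w Q * avg_s Q powr (p - 1) \<le> A"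
    and f: "f \<in> borel_measurable ms" "\<And>x. 0 \<le> f x" "integrable ms (\<lambda>x. f x powr p)"
    and g: "g \<in> borel_measurable mw" "\<And>x. 0 \<le> g x" "integrable mw (\<lambda>x. g x powr (p / (p - r)))"
    and v: "packing Kv S (measure mw)" "0 \<le> Kv"
  defines "a \<equiv> \<lambda>Q. (LINT x:Q|ms. f x) / measure ms Q"
    and "b \<equiv> \<lambda>Q. (LINT x:Q|mw. g x) / measure mw Q"
  shows "(\<Sum>Q\<in>S. a Q powr r * b Q * (avg_s Q powr r * measure mw Q))
    \<le> 2 * (\<Lambda> / exponent_gap p r) * maximal_const p powr (r / p) * maximal_const (p / (p - r)) powr (1 - r / p)
        * (Kv powr (1 - r / p) + Ks powr (r / p))
        * ((LINT x|ms. f x powr p) powr (r / p) * (LINT x|mw. g x powr (p / (p - r))) powr (1 - r / p))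
        * (A powr (r / p) / (1 - (1 / 2) powr (r / p)))"
    (is "?lhs \<le> ?C * (A powr ?t / (1 - ?\<rho>))")
proof -
  define l where "l Q = avg_w Q * avg_s Q powr (p - 1)" for Q
  have l: "0 < l Q" "l Q \<le> A" if "Q \<in> S" for Q
    using av_pos[OF that] Ap[OF that] by (simp_all add: l_def)
  \<comment> \<open>The slice of \<open>Q\<close>: \<open>l Q\<close> lies between \<open>2\<^bsup>-k-1\<^esup> A\<close> and \<open>2\<^bsup>-k\<^esup> A\<close>.\<close>
  define k where "k Q = nat \<lfloor>log 2 (A / l Q)\<rfloor>" for Q
  have k: "A * (1 / 2) ^ k Q / 2 < l Q \<and> l Q \<le> A * (1 / 2) ^ k Q" if Q: "Q \<in> S" for Q
  proof -
    have "1 \<le> A / l Q" using l[OF Q] by simp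
    then have "real (k Q) \<le> log 2 (A / l Q)" "log 2 (A / l Q) < real (k Q) + 1"
      unfolding k_def by (auto simp: zero_le_log_cancel_iff of_nat_nat)
    then have "2 powr real (k Q) \<le> A / l Q" "A / l Q < 2 powr (real (k Q) + 1)"
      using l[OF Q] A by (simp_all add: le_log_iff log_less_iff)
    then have "2 ^ k Q \<le> A / l Q" "A / l Q < 2 ^ k Q * 2"
      by (simp_all add: powr_add powr_realpow)
    then show ?thesis using l[OF Q] A by (simp add: field_simps power_divide)
  qed
  let ?T = "\<lambda>n. {Q\<in>S. k Q = n}"
  let ?term = "\<lambda>Q. a Q powr r * b Q * (avg_s Q powr r * measure mw Q)"
  have \<rho>: "0 < ?\<rho>" "?\<rho> < 1" using p powr_less_mono2[of ?t "1/2" 1] by auto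
  have C0: "0 \<le> ?C" using constants v(2) exponent_gap_pos[OF p] by simp
  have slice: "sum ?term (?T n) \<le> ?C * (A powr ?t * ?\<rho> ^ n)" for n
  proof -
    interpret T: two_weight_family "?T n" ms mw L \<Lambda> Ks
      by (rule two_weight_subfamily) auto
    have v': "packing Kv (?T n) (measure mw)" "0 \<le> Kv"
      using v packing_subset[OF v(1) _ s.finite_family] by auto
    have "sum ?term (?T n) \<le> ?C * (A * (1 / 2) ^ n) powr ?t"
      unfolding a_def b_def
    proof (rule T.slice_bound[OF p _ _ f g v', unfolded T.avg_s_def T.avg_w_def, folded avg_s_def avg_w_def])
      show "0 < A * (1 / 2) ^ n" using A by simp
      fix Q assume "Q \<in> ?T n"
      then show "A * (1 / 2) ^ n / 2 < avg_w Q * avg_s Q powr (p - 1) \<and> avg_w Q * avg_s Q powr (p - 1) \<le> A * (1 / 2) ^ n"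
        using k[of Q] by (auto simp: l_def)
    qed
    also have "(A * (1 / 2) ^ n) powr ?t = A powr ?t * ?\<rho> ^ n"
      using A by (simp add: powr_mult powr_realpow[symmetric] powr_powr mult.commute)
    finally show ?thesis .
  qed
  have "?lhs = (\<Sum>n\<in>k ` S. sum ?term (?T n))"
    using sum.image_gen[OF s.finite_family, of ?term k] .
  also have "\<dots> \<le> (\<Sum>n\<in>k ` S. ?C * (A powr ?t * ?\<rho> ^ n))"
    by (intro sum_mono slice)
  also have "\<dots> = ?C * (A powr ?t * (\<Sum>n\<in>k ` S. ?\<rho> ^ n))"
    by (simp add: sum_distrib_left)
  also have "\<dots> \<le> ?C * (A powr ?t * (1 / (1 - ?\<rho>)))"
  proof (intro mult_left_mono C0)
    have "(\<Sum>n\<in>k ` S. ?\<rho> ^ n) \<le> (\<Sum>n. ?\<rho> ^ n)"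
      using \<rho> s.finite_family by (intro sum_le_suminf) (auto intro: summable_geometric)
    then show "(\<Sum>n\<in>k ` S. ?\<rho> ^ n) \<le> 1 / (1 - ?\<rho>)"
      using \<rho> by (simp add: suminf_geometric)
  qed auto
  finally show ?thesis by simp
qed

end

context two_weight_family
begin

text \<open>
  The \<open>r\<close>-th power of the sparse operator applied to \<open>f \<sigma>\<close>.
\<close>

definition family_sum :: "real \<Rightarrow> ('a \<Rightarrow> real) \<Rightarrow> 'a \<Rightarrow> real" where
  "family_sum r f x = (\<Sum>Q\<in>S. ((LINT y:Q|ms. f y) / L Q) powr r * indicator Q x)"

lemma family_sum_nonneg: "0 \<le> family_sum r f x"
  unfolding family_sum_def by (intro sum_nonneg) auto

lemma family_sum_measurable: "family_sum r f \<in> borel_measurable mw"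
  unfolding family_sum_def using v.family_sets by (intro borel_measurable_sum borel_measurable_times) auto

lemma integrable_family_sum_powr:
  assumes "0 < t" shows "integrable mw (\<lambda>x. family_sum r f x powr t)"
proof (rule Bochner_Integration.integrable_bound)
  let ?c = "\<Sum>Q\<in>S. ((LINT y:Q|ms. f y) / L Q) powr r"
  show "integrable mw (\<lambda>x. ?c powr t * (\<Sum>Q\<in>S. indicator Q x))"
    using v.set_integrable_const[of _ 1] by (simp add: set_integrable_def)
  show "(\<lambda>x. family_sum r f x powr t) \<in> borel_measurable mw"
    using family_sum_measurable by measurable
  show "AE x in mw. norm (family_sum r f x powr t) \<le> norm (?c powr t * (\<Sum>Q\<in>S. indicator Q x))"
  proof (rule AE_I2)
    fix x
    have ind0: "0 \<le> (\<Sum>Q\<in>S. indicator Q x :: real)" by (intro sum_nonneg) auto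
    show "norm (family_sum r f x powr t) \<le> norm (?c powr t * (\<Sum>Q\<in>S. indicator Q x))"
    proof (cases "\<exists>Q\<in>S. x \<in> Q")
      case True
      then obtain Q where Q: "Q \<in> S" "x \<in> Q" by blast
      have "(1 :: real) \<le> (\<Sum>Q\<in>S. indicator Q x)"
        using member_le_sum[of Q S "\<lambda>Q. indicator Q x :: real"] Q s.finite_family by simp
      moreover have "family_sum r f x powr t \<le> ?c powr t"
        using assms family_sum_nonneg unfolding family_sum_def
        by (intro powr_mono2 sum_mono sum_nonneg) (auto simp: indicator_def)
      ultimately have "family_sum r f x powr t * 1 \<le> ?c powr t * (\<Sum>Q\<in>S. indicator Q x)"
        by (intro mult_mono) auto
      then show ?thesis using ind0 by simp
    next
      case False
      then have "family_sum r f x = 0" by (simp add: family_sum_def indicator_def)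
      then show ?thesis by simp
    qed
  qed
qed

text \<open>
  The function \<open>g = h\<^bsup>p/r-1\<^esup>\<close> is the extremiser of the duality between \<open>L\<^bsup>p/r\<^esup>(w)\<close> and its dual, since
  \<open>h g = g\<^bsup>p/(p-r)\<^esup> = h\<^bsup>p/r\<^esup>\<close>.  Testing with it bounds the integral \<open>X\<close> of \<open>h\<^bsup>p/r\<^esup>\<close> by a multiple of \<open>X\<^bsup>1-r/p\<^esup>\<close>,
  which may be divided out because \<open>X\<close> is finite for a finite family.
\<close>

lemma family_sum_bound_small_exponent:
  assumes p: "1 < p" "0 < r" "r < p" and A: "0 < A"
    and Ap: "\<And>Q. Q \<in> S \<Longrightarrow> avg_w Q * avg_s Q powr (p - 1) \<le> A"
    and f: "f \<in> borel_measurable ms" "\<And>x. 0 \<le> f x" "integrable ms (\<lambda>x. f x powr p)"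
    and v: "packing Kv S (measure mw)" "0 \<le> Kv"
  shows "(LINT x|mw. family_sum r f x powr (p / r)) powr (1 / p)
    \<le> (2 * (2 * (\<Lambda> / exponent_gap p r) * maximal_const p powr (r / p)
          * maximal_const (p / (p - r)) powr (1 - r / p) / (1 - (1 / 2) powr (r / p)))) powr (1 / r)
      * A powr (1 / p) * (Kv powr (1 / r - 1 / p) + Ks powr (1 / p)) * (LINT x|ms. f x powr p) powr (1 / p)"
proof -
  let ?t = "r / p" and ?q = "p / (p - r)"
  let ?h = "family_sum r f"
  let ?g = "\<lambda>x. ?h x powr (p / r - 1)"
  let ?X = "LINT x|mw. ?h x powr (p / r)" and ?F = "LINT x|ms. f x powr p"
  let ?C = "2 * (\<Lambda> / exponent_gap p r) * maximal_const p powr (r / p)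
          * maximal_const (p / (p - r)) powr (1 - r / p) / (1 - (1 / 2) powr (r / p))"
  let ?K = "Kv powr (1 - ?t) + Ks powr ?t"
  have t: "0 < ?t" "?t < 1" and q: "1 < ?q" using p by (auto simp: field_simps)
  have powr_mult4: "(a * b * c * d) powr e = a powr e * b powr e * c powr e * d powr e" for a b c d e :: real
    by (simp only: powr_mult)
  have gq: "?g x powr ?q = ?h x powr (p / r)" for x
  proof -
    have "p / r - 1 = (p - r) / r" using p by (simp add: diff_divide_distrib)
    then have "(p / r - 1) * ?q = p / r" using p by simp
    then show ?thesis by (simp only: powr_powr)
  qed
  have g_meas: "?g \<in> borel_measurable mw"
    using family_sum_measurable by measurable
  have g_int: "integrable mw (\<lambda>x. ?g x powr ?q)"
    unfolding gq by (rule integrable_family_sum_powr) (use p in simp)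
  have g: "?g \<in> borel_measurable mw" "\<And>x. 0 \<le> ?g x" "integrable mw (\<lambda>x. ?g x powr ?q)"
    using g_meas g_int by auto
  have X0: "0 \<le> ?X" "0 \<le> ?F" by (auto intro!: integral_nonneg)
  have \<rho>: "0 < 1 - (1 / 2) powr ?t" using p powr_less_mono2[of ?t "1/2" 1] by auto
  have C0: "0 \<le> ?C" using \<rho> constants exponent_gap_pos[OF p] by simp
  have "?X = (LINT x|mw. (\<Sum>Q\<in>S. ((LINT y:Q|ms. f y) / L Q) powr r * (indicator Q x * ?g x)))"
  proof (rule Bochner_Integration.integral_cong)
    fix x
    have "?h x powr (p / r) = ?h x * ?g x"
      using powr_mult_base[OF family_sum_nonneg, of r f x "p / r - 1"] by simp
    then show "?h x powr (p / r) = (\<Sum>Q\<in>S. ((LINT y:Q|ms. f y) / L Q) powr r * (indicator Q x * ?g x))"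
      by (subst (asm) (2) family_sum_def) (simp add: sum_distrib_right mult.assoc)
  qed simp
  also have "\<dots> = (\<Sum>Q\<in>S. ((LINT y:Q|ms. f y) / L Q) powr r * (LINT x:Q|mw. ?g x))"
    using v.set_integrable_of_powr[OF _ q g]
    by (subst Bochner_Integration.integral_sum) (auto simp: set_integrable_def set_lebesgue_integral_def)
  also have "\<dots> = (\<Sum>Q\<in>S. ((LINT y:Q|ms. f y) / measure ms Q) powr r * ((LINT x:Q|mw. ?g x) / measure mw Q)
      * (avg_s Q powr r * measure mw Q))"
  proof (rule sum.cong)
    fix Q assume Q: "Q \<in> S"
    have I: "0 \<le> (LINT y:Q|ms. f y)"
      unfolding set_lebesgue_integral_def using f(2) by (auto intro!: integral_nonneg)
    have "(LINT y:Q|ms. f y) / L Q = (LINT y:Q|ms. f y) / measure ms Q * avg_s Q"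
      using s.family_pos[OF Q] by (simp add: avg_s_def)
    moreover have "((LINT y:Q|ms. f y) / measure ms Q * avg_s Q) powr r
        = ((LINT y:Q|ms. f y) / measure ms Q) powr r * avg_s Q powr r"
      by (rule powr_mult)
    ultimately have "((LINT y:Q|ms. f y) / L Q) powr r
        = ((LINT y:Q|ms. f y) / measure ms Q) powr r * avg_s Q powr r"
      by (simp only:)
    then show "((LINT y:Q|ms. f y) / L Q) powr r * (LINT x:Q|mw. ?g x)
        = ((LINT y:Q|ms. f y) / measure ms Q) powr r * ((LINT x:Q|mw. ?g x) / measure mw Q)
          * (avg_s Q powr r * measure mw Q)"
      using v.family_pos[OF Q] by simp
  qed simp
  also have "\<dots> \<le> 2 * (\<Lambda> / exponent_gap p r) * maximal_const p powr ?t * maximal_const ?q powr (1 - ?t)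
        * ?K * (?F powr ?t * ?X powr (1 - ?t)) * (A powr ?t / (1 - (1 / 2) powr ?t))"
    using bilinear_bound[OF p A Ap f g v] unfolding gq .
  also have "\<dots> = (?C * ?K * A powr ?t * ?F powr ?t) * ?X powr (1 - ?t)" by simp
  finally have main: "?X \<le> (?C * ?K * A powr ?t * ?F powr ?t) * ?X powr (1 - ?t)" .
  have "?X powr ?t \<le> ?C * ?K * A powr ?t * ?F powr ?t"
  proof (cases "?X = 0")
    case False
    then have X: "0 < ?X" using X0(1) by (metis order_le_less)
    have "?X powr ?t * ?X powr (1 - ?t) = ?X" using X by (simp flip: powr_add)
    then have "?X powr ?t * ?X powr (1 - ?t) \<le> (?C * ?K * A powr ?t * ?F powr ?t) * ?X powr (1 - ?t)"
      using main by simp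
    then show ?thesis using X by (simp only: mult_le_cancel_right) simp
  next
    case True
    have "0 \<le> ?C * ?K * A powr ?t * ?F powr ?t"
      by (intro mult_nonneg_nonneg C0) auto
    moreover have "?X powr ?t = 0" using True by simp
    ultimately show ?thesis by (simp only:)
  qed
  moreover have "?K \<le> 2 * max (Kv powr (1 - ?t)) (Ks powr ?t)" by simp
  ultimately have "?X powr ?t \<le> ?C * (2 * max (Kv powr (1 - ?t)) (Ks powr ?t)) * A powr ?t * ?F powr ?t"
    using C0 by (elim order_trans) (intro mult_right_mono mult_left_mono, auto)
  then have "(?X powr ?t) powr (1 / r)
      \<le> ((2 * ?C) * max (Kv powr (1 - ?t)) (Ks powr ?t) * A powr ?t * ?F powr ?t) powr (1 / r)"
    using p by (intro powr_mono2) (auto simp: mult_ac)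
  also have "\<dots> = (2 * ?C) powr (1 / r) * max (Kv powr (1 - ?t)) (Ks powr ?t) powr (1 / r)
      * (A powr ?t) powr (1 / r) * (?F powr ?t) powr (1 / r)"
    by (rule powr_mult4)
  also have "max (Kv powr (1 - ?t)) (Ks powr ?t) powr (1 / r)
      \<le> (Kv powr (1 - ?t)) powr (1 / r) + (Ks powr ?t) powr (1 / r)"
    by (simp add: max_def)
  also have "\<dots> = Kv powr (1 / r - 1 / p) + Ks powr (1 / p)"
  proof -
    have "(1 - ?t) * (1 / r) = 1 / r - 1 / p" "?t * (1 / r) = 1 / p" using p by (auto simp: field_simps)
    then show ?thesis by (simp only: powr_powr)
  qed
  finally have "(?X powr ?t) powr (1 / r)
      \<le> (2 * ?C) powr (1 / r) * (Kv powr (1 / r - 1 / p) + Ks powr (1 / p))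
        * (A powr ?t) powr (1 / r) * (?F powr ?t) powr (1 / r)"
    by (simp add: mult_right_mono mult_left_mono)
  moreover have "?t * (1 / r) = 1 / p" using p by simp
  ultimately show ?thesis by (simp only: powr_powr mult_ac)
qed

text \<open>
  Now \<open>p/r \<le> 1\<close>, so the sum over the cubes may be pulled out of the power.
\<close>

lemma family_sum_bound_large_exponent:
  assumes p: "1 < p" "p \<le> r" and A: "0 < A"
    and Ap: "\<And>Q. Q \<in> S \<Longrightarrow> avg_w Q * avg_s Q powr (p - 1) \<le> A"
    and f: "f \<in> borel_measurable ms" "\<And>x. 0 \<le> f x" "integrable ms (\<lambda>x. f x powr p)"
  shows "(LINT x|mw. family_sum r f x powr (p / r)) powr (1 / p)
    \<le> maximal_const p powr (1 / p) * A powr (1 / p) * Ks powr (1 / p) * (LINT x|ms. f x powr p) powr (1 / p)"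
proof -
  let ?h = "family_sum r f"
  let ?X = "LINT x|mw. ?h x powr (p / r)" and ?F = "LINT x|ms. f x powr p"
  define c where "c Q = (LINT y:Q|ms. f y) / L Q" for Q
  define a where "a Q = (LINT y:Q|ms. f y) / measure ms Q" for Q
  note S = s.finite_family s.laminar_family s.empty_notin
  have I: "0 \<le> (LINT y:Q|ms. f y)" for Q
    unfolding set_lebesgue_integral_def using f(2) by (auto intro!: integral_nonneg)
  have a0: "0 \<le> a Q" for Q using I by (simp add: a_def)
  have X0: "0 \<le> ?X" "0 \<le> ?F" by (auto intro!: integral_nonneg)
  have h_le: "?h x powr (p / r) \<le> (\<Sum>Q\<in>S. c Q powr p * indicator Q x)" for x
  proof -
    have "?h x powr (p / r) \<le> (\<Sum>Q\<in>S. (c Q powr r * indicator Q x) powr (p / r))"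
      unfolding family_sum_def c_def using S(1) p by (intro powr_sum_le) auto
    also have "\<dots> = (\<Sum>Q\<in>S. c Q powr p * indicator Q x)"
      using p by (intro sum.cong) (auto simp: powr_powr indicator_def)
    finally show ?thesis .
  qed
  have int: "integrable mw (\<lambda>x. c Q powr p * indicator Q x)" if "Q \<in> S" for Q
    using v.set_integrable_const[OF that, of 1] by (simp add: set_integrable_def)
  have "?X \<le> (LINT x|mw. (\<Sum>Q\<in>S. c Q powr p * indicator Q x))"
    using p int by (intro integral_mono integrable_family_sum_powr h_le) auto
  also have "\<dots> = (\<Sum>Q\<in>S. c Q powr p * measure mw Q)"
    using int v.family_sets by (subst Bochner_Integration.integral_sum) (auto intro!: sum.cong)
  also have "\<dots> \<le> (\<Sum>Q\<in>S. A * (a Q powr p * measure ms Q))"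
  proof (rule sum_mono)
    fix Q assume Q: "Q \<in> S"
    have "c Q = a Q * avg_s Q"
      using s.family_pos[OF Q] by (simp add: avg_s_def a_def c_def)
    then have "c Q powr p = a Q powr p * avg_s Q powr p"
      using a0 av_pos[OF Q] by (simp add: powr_mult)
    also have "avg_s Q powr p = avg_s Q powr (p - 1) * avg_s Q"
      using powr_mult_base[of "avg_s Q" "p - 1"] av_pos(1)[OF Q] by (simp add: mult.commute)
    finally have "c Q powr p * measure mw Q
        = (avg_w Q * avg_s Q powr (p - 1)) * (a Q powr p * measure ms Q)"
      using L_pos[OF Q] by (simp add: avg_w_def avg_s_def)
    also have "\<dots> \<le> A * (a Q powr p * measure ms Q)"
      using Ap[OF Q] by (intro mult_right_mono) auto
    finally show "c Q powr p * measure mw Q \<le> A * (a Q powr p * measure ms Q)" .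
  qed
  also have "\<dots> = A * (\<Sum>Q\<in>S. a Q powr p * measure ms Q)" by (simp add: sum_distrib_left)
  also have "\<dots> \<le> A * (Ks * (maximal_const p * ?F))"
  proof (rule mult_left_mono)
    have "(\<Sum>Q\<in>S. a Q powr p * measure ms Q)
        \<le> (\<Sum>Q\<in>S. fam_max (\<lambda>Q. a Q powr p) {P\<in>S. Q \<subseteq> P} * measure ms Q)"
      using S(1) by (intro sum_mono mult_right_mono fam_max_upper) auto
    also have "\<dots> \<le> Ks * (\<Sum>R\<in>S. jump (fam_max (\<lambda>Q. a Q powr p)) S R * measure ms R)"
      by (rule sum_le_sum_jump[OF S _ jump_fam_max_nonneg[OF S(1)] s_packing]) simp
    also have "\<dots> \<le> Ks * (maximal_const p * ?F)"
      using s.maximal_inequality[OF p(1) f] constants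
      by (intro mult_left_mono) (auto simp: a_def maximal_const_def)
    finally show "(\<Sum>Q\<in>S. a Q powr p * measure ms Q) \<le> Ks * (maximal_const p * ?F)" .
  qed (use A in simp)
  finally have "?X powr (1 / p) \<le> (A * (Ks * (maximal_const p * ?F))) powr (1 / p)"
    using X0 p by (intro powr_mono2) auto
  then show ?thesis
    using A constants X0 maximal_const_pos[OF p(1)] by (simp add: powr_mult mult_ac)
qed

end

section \<open>Powers of extended nonnegative reals\<close>

lemma ennpowr_0 [simp]: "ennpowr x 0 = 1"
  by (simp add: ennpowr_def)

lemma ennpowr_top: "a \<noteq> 0 \<Longrightarrow> ennpowr top a = top"
  by (simp add: ennpowr_def)

lemma ennpowr_ennreal: "0 \<le> x \<Longrightarrow> a \<noteq> 0 \<Longrightarrow> ennpowr (ennreal x) a = ennreal (x powr a)"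
  by (simp add: ennpowr_def)

lemma ennpowr_zero: "a \<noteq> 0 \<Longrightarrow> ennpowr 0 a = 0"
  by (simp add: ennpowr_def)

lemma ennpowr_mono:
  assumes "0 \<le> a" "x \<le> y" shows "ennpowr x a \<le> ennpowr y a"
proof (cases "a = 0 \<or> y = top")
  case False
  then obtain u v where "x = ennreal u" "y = ennreal v" "0 \<le> u" "0 \<le> v"
    using assms(2) by (cases x; cases y) (auto simp: top_unique)
  then show ?thesis using assms False by (simp add: ennpowr_ennreal powr_mono2 ennreal_leI)
qed (cases "a = 0"; auto simp: ennpowr_top)

lemma ennpowr_ennpowr:
  assumes "0 < a" "0 < b" shows "ennpowr (ennpowr x a) b = ennpowr x (a * b)"
  using assms by (cases x) (simp_all add: ennpowr_ennreal ennpowr_top powr_powr)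

lemma ennpowr_1 [simp]: "ennpowr x 1 = x"
  by (cases x) (simp_all add: ennpowr_ennreal ennpowr_top)

lemma ennpowr_SUP:
  fixes f :: "'i \<Rightarrow> ennreal"
  assumes a: "0 < a" shows "ennpowr (SUP i\<in>I. f i) a = (SUP i\<in>I. ennpowr (f i) a)"
proof (rule antisym)
  have "f i \<le> ennpowr (SUP i\<in>I. ennpowr (f i) a) (1 / a)" if "i \<in> I" for i
  proof -
    have "ennpowr (ennpowr (f i) a) (1 / a) \<le> ennpowr (SUP i\<in>I. ennpowr (f i) a) (1 / a)"
      using a that by (intro ennpowr_mono SUP_upper) auto
    then show ?thesis using a by (simp add: ennpowr_ennpowr)
  qed
  then have "ennpowr (SUP i\<in>I. f i) a \<le> ennpowr (ennpowr (SUP i\<in>I. ennpowr (f i) a) (1 / a)) a"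
    using a by (intro ennpowr_mono SUP_least) auto
  then show "ennpowr (SUP i\<in>I. f i) a \<le> (SUP i\<in>I. ennpowr (f i) a)"
    using a by (simp add: ennpowr_ennpowr)
  show "(SUP i\<in>I. ennpowr (f i) a) \<le> ennpowr (SUP i\<in>I. f i) a"
    using a by (intro SUP_least ennpowr_mono SUP_upper) auto
qed

lemma ennpowr_measurable [measurable]:
  fixes f :: "'a \<Rightarrow> ennreal"
  assumes [measurable]: "f \<in> borel_measurable M"
  shows "(\<lambda>x. ennpowr (f x) a) \<in> borel_measurable M"
proof -
  have [measurable]: "Measurable.pred M (\<lambda>x. f x = top)"
    using measurable_sets[OF assms, of "{top}"] by (simp add: pred_def vimage_def Int_def conj_commute)
  have "(\<lambda>x. if f x = top then top else ennreal (enn2real (f x) powr a)) \<in> borel_measurable M"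
    by measurable
  then show ?thesis by (cases "a = 0") (simp_all add: ennpowr_def)
qed

section \<open>Dyadic cubes\<close>

lemma half_open_cube_eq: "half_open_cube a l = (\<Inter>i. {x. a $ i \<le> x $ i} \<inter> {x. x $ i < a $ i + l})"
  by (auto simp: half_open_cube_def)

lemma half_open_cube_sets: "half_open_cube (a :: real ^ 'n) l \<in> sets borel"
proof -
  have "closed {x :: real ^ 'n. a $ i \<le> x $ i}" "open {x :: real ^ 'n. x $ i < a $ i + l}" for i
    using closed_halfspace_component_ge_cart[of "a $ i" i] open_halfspace_component_lt_cart[of i "a $ i + l"]
    by simp_all
  then show ?thesis
    unfolding half_open_cube_eq by (intro sets.countable_INT'' sets.Int) auto
qed

lemma half_open_cube_subset_cbox: "half_open_cube a l \<subseteq> cbox a (\<chi> i. a $ i + l)"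
  by (auto simp: half_open_cube_def mem_box_cart less_imp_le)

lemma box_subset_half_open_cube: "box a (\<chi> i. a $ i + l) \<subseteq> half_open_cube a l"
  by (auto simp: half_open_cube_def mem_box_cart less_imp_le)

lemma box_cube_nonempty: "0 < l \<Longrightarrow> box (a :: real ^ 'n) (\<chi> i. a $ i + l) \<noteq> {}"
proof -
  assume "0 < l"
  then have "(\<chi> i. a $ i + l / 2) \<in> box a (\<chi> i. a $ i + l)" by (simp add: mem_box_cart)
  then show ?thesis by blast
qed

lemma dyadic_systemE:
  assumes "dyadic_system D"
  obtains G :: "int \<Rightarrow> (real ^ 'n) set set" where "D = (\<Union>k. G k)" "\<forall>k. partition_on UNIV (G k)"
    "\<forall>k. \<forall>Q\<in>G k. \<exists>a. Q = half_open_cube a (2 powi (- k))"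
    "\<forall>k. \<forall>Q\<in>G (k + 1). \<exists>P\<in>G k. Q \<subseteq> P"
  using assms unfolding dyadic_system_def by (elim exE conjE) (rule that)

lemma dyadic_cube:
  assumes "dyadic_system D" "Q \<in> D"
  obtains a l where "0 < l" "Q = half_open_cube a l"
proof -
  obtain G where D: "D = (\<Union>k. G k)" and part: "\<forall>k. partition_on UNIV (G k)"
    and cubes: "\<forall>k. \<forall>Q\<in>G k. \<exists>a. Q = half_open_cube a (2 powi (- k))"
    and refine: "\<forall>k. \<forall>Q\<in>G (k + 1). \<exists>P\<in>G k. Q \<subseteq> P"
    by (rule dyadic_systemE[OF assms(1)])
  obtain k where "Q \<in> G k" using assms(2) D by blast
  then obtain a where "Q = half_open_cube a (2 powi (- k))" using cubes by blast
  moreover have "(0 :: real) < 2 powi (- k)" by (rule zero_less_power_int) simp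
  ultimately show ?thesis using that by blast
qed

lemma dyadic_cube_facts:
  fixes D :: "(real ^ 'n) set set"
  assumes D: "dyadic_system D" and Q: "Q \<in> D"
  shows dyadic_cube_sets: "Q \<in> sets lebesgue"
    and dyadic_cube_finite: "emeasure lebesgue Q < \<infinity>"
    and dyadic_cube_pos: "0 < emeasure lebesgue Q"
    and dyadic_cube_interior: "interior Q \<noteq> {}"
    and dyadic_cube_compact: "\<exists>K. compact K \<and> Q \<subseteq> K"
proof -
  obtain a l where l: "0 < l" and Qeq: "Q = half_open_cube a l" by (rule dyadic_cube[OF assms])
  let ?b = "\<chi> i. a $ i + l"
  show sets: "Q \<in> sets lebesgue" unfolding Qeq by (intro sets_completionI_sets) (simp add: half_open_cube_sets)
  have sub: "Q \<subseteq> cbox a ?b" "box a ?b \<subseteq> Q"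
    unfolding Qeq by (rule half_open_cube_subset_cbox box_subset_half_open_cube)+
  then show "\<exists>K. compact K \<and> Q \<subseteq> K" using compact_cbox by blast
  have "emeasure lebesgue Q \<le> emeasure lebesgue (cbox a ?b)"
    using sub by (intro emeasure_mono) auto
  also have "\<dots> < \<infinity>" by (simp add: emeasure_lborel_cbox_eq)
  finally show "emeasure lebesgue Q < \<infinity>" .
  have "emeasure lebesgue (box a ?b) \<noteq> 0"
    using box_cube_nonempty[OF l, of a] open_not_negligible[of "box a ?b"]
    by (auto simp: negligible_iff_emeasure0 open_box)
  moreover have "emeasure lebesgue (box a ?b) \<le> emeasure lebesgue Q"
    using sub sets by (intro emeasure_mono)
  ultimately show "0 < emeasure lebesgue Q" by (auto simp: zero_less_iff_neq_zero)
  show "interior Q \<noteq> {}"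
    using interior_maximal[OF sub(2)] box_cube_nonempty[OF l, of a] by auto
qed

text \<open>
  A cube lies in a cube of every coarser generation, and cubes of one generation are disjoint.
\<close>

lemma dyadic_system_laminar:
  assumes "dyadic_system D" shows "laminar D"
proof -
  obtain G where D: "D = (\<Union>k. G k)" and part: "\<forall>k. partition_on UNIV (G k)"
    and cubes: "\<forall>k. \<forall>Q\<in>G k. \<exists>a. Q = half_open_cube a (2 powi (- k))"
    and refine: "\<forall>k. \<forall>Q\<in>G (k + 1). \<exists>P\<in>G k. Q \<subseteq> P"
    by (rule dyadic_systemE[OF assms])
  have anc: "\<exists>P\<in>G j. Q \<subseteq> P" if "j \<le> k" "Q \<in> G k" for j k Q
    using that
  proof (induction arbitrary: Q rule: int_ge_induct)
    case (step k)
    obtain P where "P \<in> G k" "Q \<subseteq> P" using refine step.prems by blast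
    then show ?case using step.IH[of P] by blast
  qed blast
  have same: "P = P' \<or> P \<inter> P' = {}" if "P \<in> G j" "P' \<in> G j" for P P' j
    using part[rule_format, of j] that by (auto simp: partition_on_def disjoint_def)
  have "Q \<subseteq> P \<or> P \<inter> Q = {}" if jk: "j \<le> k" and PQ: "P \<in> G j" "Q \<in> G k" for P Q j k
  proof -
    obtain P' where "P' \<in> G j" "Q \<subseteq> P'" using anc[OF jk PQ(2)] by blast
    then show ?thesis using same[OF PQ(1)] by blast
  qed
  then show ?thesis
    unfolding laminar_def D by (metis Int_commute UN_E linear)
qed

text \<open>
  The cubes of one generation have disjoint nonempty interiors.
\<close>

lemma dyadic_system_countable:
  fixes D :: "(real ^ 'n) set set"
  assumes "dyadic_system D" shows "countable D"
proof -
  obtain G where D: "D = (\<Union>k. G k)" and part: "\<forall>k. partition_on UNIV (G k)"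
    and cubes: "\<forall>k. \<forall>Q\<in>G k. \<exists>a. Q = half_open_cube a (2 powi (- k))"
    and refine: "\<forall>k. \<forall>Q\<in>G (k + 1). \<exists>P\<in>G k. Q \<subseteq> P"
    by (rule dyadic_systemE[OF assms])
  have "countable (G k)" for k
  proof -
    have disj: "P = Q" if "P \<in> G k" "Q \<in> G k" "x \<in> interior P" "x \<in> interior Q" for P Q x
    proof -
      have "x \<in> P \<inter> Q" using that interior_subset by blast
      then show ?thesis using part[rule_format, of k] that(1,2) by (auto simp: partition_on_def disjoint_def)
    qed
    have ne: "interior P \<noteq> {}" if "P \<in> G k" for P
      using dyadic_cube_interior[OF assms] that by (auto simp: D)
    have "inj_on interior (G k)"
    proof (rule inj_onI)
      fix P Q assume PQ: "P \<in> G k" "Q \<in> G k" "interior P = interior Q"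
      obtain x where "x \<in> interior P" using ne[OF PQ(1)] by blast
      then show "P = Q" using disj[OF PQ(1,2), of x] PQ(3) by simp
    qed
    moreover have "pairwise disjnt (interior ` G k)"
      unfolding pairwise_def disjnt_iff using disj by blast
    then have "countable (interior ` G k)"
      using countable_disjoint_open_subsets[of "interior ` G k"] open_interior by blast
    ultimately show ?thesis by (rule countable_image_inj_on[rotated])
  qed
  then show ?thesis by (simp add: D)
qed

section \<open>Weights\<close>

text \<open>
  Only the restrictions to compact sets are measurable by definition; \<open>w\<close> is their pointwise limit.
\<close>

lemma weight_measurable:
  assumes "weight w" shows "w \<in> borel_measurable lebesgue"
proof (rule borel_measurable_LIMSEQ_real)
  show "(\<lambda>x. indicat_real (cball 0 (real n)) x * w x) \<in> borel_measurable lebesgue" for n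
  proof -
    have "set_integrable lebesgue (cball 0 (real n)) w"
      using assms compact_cball[of 0 "real n"] unfolding weight_def by blast
    then show ?thesis
      using borel_measurable_integrable[of lebesgue "\<lambda>x. indicat_real (cball 0 (real n)) x * w x"]
      by (simp add: set_integrable_def)
  qed
  show "(\<lambda>n. indicat_real (cball 0 (real n)) x * w x) \<longlonglongrightarrow> w x" for x
  proof (rule tendsto_eventually)
    obtain N :: nat where "norm x \<le> real N" using real_arch_simple by blast
    then show "\<forall>\<^sub>F n in sequentially. indicat_real (cball 0 (real n)) x * w x = w x"
      unfolding eventually_sequentially by (intro exI[of _ N]) (auto simp: dist_norm)
  qed
qed

lemma sets_weight_measure [simp, measurable_cong]: "sets (weight_measure w) = sets lebesgue"
  and space_weight_measure [simp]: "space (weight_measure w) = UNIV"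
  by (simp_all add: weight_measure_def)

lemma emeasure_weight_measure:
  assumes "weight w" "Q \<in> sets lebesgue"
  shows "emeasure (weight_measure w) Q = (\<integral>\<^sup>+x\<in>Q. ennreal (w x) \<partial>lebesgue)"
  unfolding weight_measure_def using assms weight_measurable[OF assms(1)] by (intro emeasure_density) auto

lemma nn_integral_weight_measure:
  assumes "weight w" "f \<in> borel_measurable lebesgue" "\<And>x. 0 \<le> f x"
  shows "(\<integral>\<^sup>+x. ennreal (f x) \<partial>weight_measure w) = (\<integral>\<^sup>+x. ennreal (f x * w x) \<partial>lebesgue)"
  unfolding weight_measure_def using assms weight_measurable[OF assms(1)]
  by (subst nn_integral_density) (auto simp: ennreal_mult' mult.commute)

lemma weight_cube:
  fixes D :: "(real ^ 'n) set set"
  assumes D: "dyadic_system D" and Q: "Q \<in> D" and w: "weight w"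
  shows "emeasure (weight_measure w) Q < \<infinity>" "0 < emeasure (weight_measure w) Q"
proof -
  obtain K where K: "compact K" "Q \<subseteq> K" using dyadic_cube_compact[OF D Q] by blast
  have sets: "Q \<in> sets lebesgue" by (rule dyadic_cube_sets[OF D Q])
  have "(\<integral>\<^sup>+x\<in>Q. ennreal (w x) \<partial>lebesgue) \<le> (\<integral>\<^sup>+x. ennreal (norm (indicat_real K x *\<^sub>R w x)) \<partial>lebesgue)"
    using K(2) by (intro nn_integral_mono) (auto simp: indicator_def intro: ennreal_leI)
  also have "\<dots> < \<infinity>"
    using w K(1) unfolding weight_def set_integrable_def by (auto simp: integrable_iff_bounded)
  finally show "emeasure (weight_measure w) Q < \<infinity>"
    by (simp add: emeasure_weight_measure[OF w sets])
  have "emeasure (weight_measure w) Q \<noteq> 0"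
  proof
    assume "emeasure (weight_measure w) Q = 0"
    then have "AE x in lebesgue. ennreal (w x) * indicator Q x = 0"
      using weight_measurable[OF w] sets
      by (simp add: emeasure_weight_measure[OF w sets] nn_integral_0_iff_AE)
    moreover have "AE x in lebesgue. w x > 0" using w by (simp add: weight_def)
    ultimately have "AE x in lebesgue. x \<notin> Q"
      by eventually_elim (auto simp: indicator_def ennreal_eq_0_iff split: if_splits)
    then have "emeasure lebesgue Q = 0"
      using sets by (subst (asm) AE_iff_measurable[OF _ refl]) auto
    then show False using dyadic_cube_pos[OF D Q] by simp
  qed
  then show "0 < emeasure (weight_measure w) Q" by (simp add: zero_less_iff_neq_zero)
qed

lemma ennreal_le_mult_of_divide_le:
  fixes a b c :: ennreal
  assumes "a / b \<le> c" "0 < b" "b < \<infinity>" shows "a \<le> c * b"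
proof -
  have "a = a / b * b" using assms(2,3) by (simp add: ennreal_divide_times)
  also have "\<dots> \<le> c * b" using assms(1) by (rule mult_right_mono) simp
  finally show ?thesis .
qed

lemma emeasure_le_twice_sparse_part:
  assumes "ennreal (1 / 2) * a \<le> b" shows "a \<le> 2 * (b :: ennreal)"
proof -
  have "ennreal 2 * ennreal (1 / 2) = ennreal (2 * (1 / 2))" by (rule ennreal_mult[symmetric]) auto
  then have "(1 :: ennreal) = 2 * ennreal (1 / 2)" by simp
  then have "a = (2 * ennreal (1 / 2)) * a" by (metis mult_1)
  also have "\<dots> = 2 * (ennreal (1 / 2) * a)" by (rule mult.assoc)
  also have "\<dots> \<le> 2 * b" using assms by (rule mult_left_mono) simp
  finally show ?thesis .
qed

context
  fixes D :: "(real ^ 'n) set set"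
  assumes D: "dyadic_system D"
begin

lemma dyadic_measured_family:
  assumes "finite T" "T \<subseteq> D" "weight w"
  shows "measured_family T (weight_measure w)"
proof
  show "laminar T" using laminar_subset[OF dyadic_system_laminar[OF D] assms(2)] .
  fix R assume "R \<in> T"
  then have R: "R \<in> D" using assms by blast
  show "R \<in> sets (weight_measure w)" using dyadic_cube_sets[OF D R] by simp
  show "emeasure (weight_measure w) R < \<infinity>" "0 < measure (weight_measure w) R"
    using weight_cube[OF D R assms(3)] by (auto simp: measure_def enn2real_positive_iff)
qed (use assms in auto)

text \<open>
  The disjoint parts \<open>E Q\<close> with \<open>Q \<subseteq> R\<close> lie in \<open>R\<close> and carry half of the measure of the cubes.
\<close>

lemma sparse_packing_lebesgue:
  assumes S: "S \<subseteq> D" "sparse_family S" and T: "finite T" "T \<subseteq> S"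
  shows "packing 2 T (measure lebesgue)"
  unfolding packing_def
proof
  fix R assume R: "R \<in> T"
  obtain E where E: "disjoint_family_on E S" "\<And>Q. Q \<in> S \<Longrightarrow> E Q \<in> sets lebesgue" "\<And>Q. Q \<in> S \<Longrightarrow> E Q \<subseteq> Q"
    "\<And>Q. Q \<in> S \<Longrightarrow> ennreal (1 / 2) * emeasure lebesgue Q \<le> emeasure lebesgue (E Q)"
    using S(2) unfolding sparse_family_def by metis
  let ?U = "{Q\<in>T. Q \<subseteq> R}"
  have cube: "Q \<in> sets lebesgue" "emeasure lebesgue Q < top" if "Q \<in> T" for Q
    using dyadic_cube_sets[OF D] dyadic_cube_finite[OF D] that S(1) T(2) by auto
  have finE: "emeasure lebesgue (E Q) < top" if "Q \<in> T" for Q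
    using emeasure_mono[of "E Q" Q lebesgue] E(3) cube[OF that] that T(2)
    by (meson le_less_trans subset_iff)
  have half: "measure lebesgue Q \<le> 2 * measure lebesgue (E Q)" if "Q \<in> T" for Q
  proof -
    have "Q \<in> S" using that T(2) by blast
    then have "enn2real (emeasure lebesgue Q) \<le> enn2real (2 * emeasure lebesgue (E Q))"
      using finE[OF that] by (intro enn2real_mono emeasure_le_twice_sparse_part E(4)) (auto simp: ennreal_mult_less_top)
    then show ?thesis by (simp add: enn2real_mult measure_def)
  qed
  have "(\<Sum>Q\<in>?U. measure lebesgue Q) \<le> (\<Sum>Q\<in>?U. 2 * measure lebesgue (E Q))"
    using half by (intro sum_mono) auto
  also have "\<dots> = 2 * measure lebesgue (\<Union>Q\<in>?U. E Q)"
  proof -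
    have "disjoint_family_on E ?U"
      using E(1) T(2) by (auto simp: disjoint_family_on_def)
    then have "measure lebesgue (\<Union>Q\<in>?U. E Q) = (\<Sum>Q\<in>?U. measure lebesgue (E Q))"
      using T E(2) finE by (intro measure_finite_Union) (auto dest: finE)
    then show ?thesis by (simp add: sum_distrib_left)
  qed
  also have "\<dots> \<le> 2 * measure lebesgue R"
  proof -
    have "(\<Union>Q\<in>?U. E Q) \<subseteq> R" using E(3) T(2) by blast
    moreover have "(\<Union>Q\<in>?U. E Q) \<in> sets lebesgue" using E(2) T by (intro sets.finite_UN) auto
    ultimately have "measure lebesgue (\<Union>Q\<in>?U. E Q) \<le> measure lebesgue R"
      using cube[OF R] by (intro measure_mono_fmeasurable) (auto simp: fmeasurable_def)
    then show ?thesis by simp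
  qed
  finally show "(\<Sum>Q | Q \<in> T \<and> Q \<subseteq> R. measure lebesgue Q) \<le> 2 * measure lebesgue R" by simp
qed

lemma average_mult_emeasure:
  assumes "Q \<in> D" "weight w"
  shows "average (\<lambda>x. ennreal (w x)) Q * emeasure lebesgue Q = emeasure (weight_measure w) Q"
  using dyadic_cube_pos[OF D assms(1)] dyadic_cube_finite[OF D assms(1)]
  unfolding average_def emeasure_weight_measure[OF assms(2) dyadic_cube_sets[OF D assms(1)]] ennreal_divide_times
  by (subst ennreal_divide_self) auto

lemma average_le_dyadic_maximal:
  assumes Q: "Q \<in> D" "Q \<subseteq> R" "x \<in> Q"
  shows "average (\<lambda>x. ennreal (w x)) Q \<le> dyadic_maximal D (\<lambda>y. indicator R y * w y) x"
proof -
  have "average (\<lambda>x. ennreal (w x)) Q \<le> average (\<lambda>y. ennreal \<bar>indicator R y * w y\<bar>) Q"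
    unfolding average_def using Q(2)
    by (intro divide_right_mono_ennreal nn_integral_mono) (auto simp: indicator_def intro!: ennreal_leI)
  also have "\<dots> = average (\<lambda>y. ennreal \<bar>indicator R y * w y\<bar>) Q * indicator Q x"
    using Q(3) by simp
  also have "\<dots> \<le> dyadic_maximal D (\<lambda>y. indicator R y * w y) x"
    unfolding dyadic_maximal_def using Q(1) by (rule SUP_upper)
  finally show ?thesis .
qed

lemma maximal_integral_le:
  assumes R: "R \<in> D" and w: "weight w"
  shows "(\<integral>\<^sup>+x\<in>R. dyadic_maximal D (\<lambda>y. indicator R y * w y) x \<partial>lebesgue)
    \<le> Ainf_char D w * emeasure (weight_measure w) R"
proof (rule ennreal_le_mult_of_divide_le[OF _ weight_cube(2,1)[OF D R w]])
  show "(\<integral>\<^sup>+x\<in>R. dyadic_maximal D (\<lambda>y. indicator R y * w y) x \<partial>lebesgue) / emeasure (weight_measure w) R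
      \<le> Ainf_char D w"
    unfolding Ainf_char_def using R by (rule SUP_upper)
qed

text \<open>
  The mass \<open>w(Q) = \<langle>w\<rangle>\<^sub>Q |Q|\<close> is at most twice the integral of \<open>\<langle>w\<rangle>\<^sub>Q\<close> over \<open>E Q\<close>, where \<open>\<langle>w\<rangle>\<^sub>Q\<close> is at
  most the maximal function of the restriction of \<open>w\<close> to \<open>R\<close>.  The sets \<open>E Q\<close> are disjoint, so the
  integral of that maximal function over \<open>R\<close> bounds the sum.
\<close>

lemma sparse_packing_weight:
  assumes S: "S \<subseteq> D" "sparse_family S" and T: "finite T" "T \<subseteq> S" and w: "weight w"
    and Ainf: "Ainf_char D w < \<infinity>"
  shows "packing (2 * enn2real (Ainf_char D w)) T (measure (weight_measure w))"
  unfolding packing_def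
proof
  fix R assume R: "R \<in> T"
  obtain E where E: "disjoint_family_on E S" "\<And>Q. Q \<in> S \<Longrightarrow> E Q \<in> sets lebesgue" "\<And>Q. Q \<in> S \<Longrightarrow> E Q \<subseteq> Q"
    "\<And>Q. Q \<in> S \<Longrightarrow> ennreal (1 / 2) * emeasure lebesgue Q \<le> emeasure lebesgue (E Q)"
    using S(2) unfolding sparse_family_def by metis
  let ?U = "{Q\<in>T. Q \<subseteq> R}" and ?W = "weight_measure w"
  let ?av = "\<lambda>Q. average (\<lambda>x. ennreal (w x)) Q"
  let ?M = "dyadic_maximal D (\<lambda>y. indicator R y * w y)"
  have RD: "R \<in> D" using R S T by blast
  have UD: "Q \<in> D" "Q \<in> S" if "Q \<in> ?U" for Q using that S T by blast+
  have emeasure_W: "emeasure ?W Q = ennreal (measure ?W Q)" if "Q \<in> D" for Q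
    using weight_cube(1)[OF D that w] by (intro emeasure_eq_ennreal_measure) auto
  have "(\<Sum>Q\<in>?U. emeasure ?W Q) \<le> (\<Sum>Q\<in>?U. 2 * (?av Q * emeasure lebesgue (E Q)))"
  proof (rule sum_mono)
    fix Q assume Q: "Q \<in> ?U"
    have "emeasure ?W Q = ?av Q * emeasure lebesgue Q"
      using average_mult_emeasure[OF UD(1)[OF Q] w] by simp
    also have "\<dots> \<le> ?av Q * (2 * emeasure lebesgue (E Q))"
      by (intro mult_left_mono emeasure_le_twice_sparse_part E(4) UD(2)[OF Q]) simp
    finally show "emeasure ?W Q \<le> 2 * (?av Q * emeasure lebesgue (E Q))" by (simp add: mult_ac)
  qed
  also have "\<dots> = 2 * (\<integral>\<^sup>+x. (\<Sum>Q\<in>?U. ?av Q * indicator (E Q) x) \<partial>lebesgue)"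
    using E(2) UD by (subst nn_integral_sum) (auto simp: sum_distrib_left nn_integral_cmult_indicator)
  also have "\<dots> \<le> 2 * (\<integral>\<^sup>+x\<in>R. ?M x \<partial>lebesgue)"
  proof (intro mult_left_mono nn_integral_mono)
    fix x
    show "(\<Sum>Q\<in>?U. ?av Q * indicator (E Q) x) \<le> ?M x * indicator R x"
    proof (cases "\<exists>Q\<in>?U. x \<in> E Q")
      case True
      then obtain Q where Q: "Q \<in> ?U" "x \<in> E Q" by blast
      have "x \<notin> E P" if "P \<in> ?U" "P \<noteq> Q" for P
        using E(1) Q UD that by (auto simp: disjoint_family_on_def)
      then have "(\<Sum>P\<in>?U. ?av P * indicator (E P) x) = (\<Sum>P\<in>?U. if P = Q then ?av Q else 0)"
        using Q by (intro sum.cong) auto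
      also have "\<dots> = ?av Q" using Q T(1) by simp
      also have "\<dots> \<le> ?M x"
        using UD[OF Q(1)] Q E(3)[of Q] by (intro average_le_dyadic_maximal) auto
      finally show ?thesis using Q E(3)[of Q] UD(2)[OF Q(1)] by auto
    next
      case False
      then show ?thesis by (simp add: indicator_def)
    qed
  qed simp
  also have "\<dots> \<le> 2 * (Ainf_char D w * emeasure ?W R)"
    by (intro mult_left_mono maximal_integral_le[OF RD w]) simp
  also have "\<dots> = ennreal (2 * enn2real (Ainf_char D w) * measure ?W R)"
    using Ainf by (simp add: emeasure_W[OF RD] ennreal_mult mult.assoc)
  finally have "ennreal (\<Sum>Q\<in>?U. measure ?W Q) \<le> ennreal (2 * enn2real (Ainf_char D w) * measure ?W R)"
    by (subst sum_ennreal[symmetric]) (simp_all add: emeasure_W UD)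
  then show "(\<Sum>Q | Q \<in> T \<and> Q \<subseteq> R. measure ?W Q) \<le> 2 * enn2real (Ainf_char D w) * measure ?W R"
    by (simp add: ennreal_le_iff)
qed

text \<open>
  The maximal function of \<open>1\<^sub>R w\<close> is at least \<open>\<langle>w\<rangle>\<^sub>R\<close> on \<open>R\<close>.  So the right-hand side of the
  main estimate is infinite as soon as one of its factors is.
\<close>

lemma Ainf_char_ge_1:
  assumes w: "weight w" and R: "R \<in> D" shows "1 \<le> Ainf_char D w"
proof -
  let ?av = "average (\<lambda>x. ennreal (w x)) R" and ?W = "emeasure (weight_measure w) R"
  have "?W = (\<integral>\<^sup>+x\<in>R. ?av \<partial>lebesgue)"
    using average_mult_emeasure[OF R w] dyadic_cube_sets[OF D R] by (simp add: nn_integral_cmult_indicator)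
  also have "\<dots> \<le> (\<integral>\<^sup>+x\<in>R. dyadic_maximal D (\<lambda>y. indicator R y * w y) x \<partial>lebesgue)"
  proof (rule nn_integral_mono)
    fix x
    show "?av * indicator R x \<le> dyadic_maximal D (\<lambda>y. indicator R y * w y) x * indicator R x"
      using average_le_dyadic_maximal[OF R order_refl] by (auto simp: indicator_def)
  qed
  also have "\<dots> \<le> Ainf_char D w * ?W" by (rule maximal_integral_le[OF R w])
  finally have "?W / ?W \<le> Ainf_char D w * ?W / ?W" by (rule divide_right_mono_ennreal)
  moreover have "Ainf_char D w * ?W / ?W = Ainf_char D w"
    using weight_cube[OF D R w] by (intro mult_divide_eq_ennreal) auto
  ultimately show ?thesis using weight_cube[OF D R w] by simp
qed

lemma average_weight:
  assumes Q: "Q \<in> D" and w: "weight w"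
  shows "average (\<lambda>x. ennreal (w x)) Q = ennreal (measure (weight_measure w) Q / measure lebesgue Q)"
proof -
  have "emeasure (weight_measure w) Q = ennreal (measure (weight_measure w) Q)"
    "emeasure lebesgue Q = ennreal (measure lebesgue Q)"
    using weight_cube(1)[OF D Q w] dyadic_cube_finite[OF D Q]
    by (intro emeasure_eq_ennreal_measure; auto)+
  moreover have "0 < measure lebesgue Q"
    using dyadic_cube_pos[OF D Q] dyadic_cube_finite[OF D Q] by (simp add: measure_def enn2real_positive_iff)
  ultimately show ?thesis
    unfolding average_def emeasure_weight_measure[OF w dyadic_cube_sets[OF D Q], symmetric]
    by (simp add: divide_ennreal)
qed

lemma Ap_char_upper:
  assumes Q: "Q \<in> D" and w: "weight w" "weight \<sigma>" and p: "1 < p"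
  defines "a \<equiv> \<lambda>v. measure (weight_measure v) Q / measure lebesgue Q"
  shows "ennreal (a w * a \<sigma> powr (p - 1)) \<le> Ap_char D p w \<sigma>" and "0 < a w * a \<sigma> powr (p - 1)"
proof -
  have L: "0 < measure lebesgue Q"
    using dyadic_cube_pos[OF D Q] dyadic_cube_finite[OF D Q] by (simp add: measure_def enn2real_positive_iff)
  have a: "0 < a v" if "weight v" for v
    using weight_cube[OF D Q that] L by (simp add: a_def measure_def enn2real_positive_iff)
  then show "0 < a w * a \<sigma> powr (p - 1)" using a[OF w(1)] a[OF w(2)] by simp
  have av: "average (\<lambda>x. ennreal (v x)) Q = ennreal (a v)" if "weight v" for v
    unfolding a_def by (rule average_weight[OF Q that])
  have "ennreal (a w * a \<sigma> powr (p - 1))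
      = average (\<lambda>x. ennreal (w x)) Q * ennpowr (average (\<lambda>x. ennreal (\<sigma> x)) Q) (p - 1)"
    unfolding av[OF w(1)] av[OF w(2)] using p a[OF w(1)] a[OF w(2)] by (simp add: ennpowr_ennreal ennreal_mult less_imp_le)
  also have "\<dots> \<le> Ap_char D p w \<sigma>"
    unfolding Ap_char_def using Q by (rule SUP_upper)
  finally show "ennreal (a w * a \<sigma> powr (p - 1)) \<le> Ap_char D p w \<sigma>" .
qed

lemma dyadic_two_weight_family:
  assumes S: "S \<subseteq> D" "sparse_family S" and T: "finite T" "T \<subseteq> S" and w: "weight w" "weight \<sigma>"
    and Ainf: "Ainf_char D \<sigma> < \<infinity>"
  shows "two_weight_family T (weight_measure \<sigma>) (weight_measure w) (measure lebesgue)
    2 (2 * enn2real (Ainf_char D \<sigma>))"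
proof -
  have TD: "T \<subseteq> D" using S T by blast
  interpret s: measured_family T "weight_measure \<sigma>"
    by (rule dyadic_measured_family[OF T(1) TD w(2)])
  interpret v: measured_family T "weight_measure w"
    by (rule dyadic_measured_family[OF T(1) TD w(1)])
  show ?thesis
  proof
    show "0 < measure lebesgue Q" if "Q \<in> T" for Q
      using dyadic_cube_pos[OF D, of Q] dyadic_cube_finite[OF D, of Q] that TD
      by (auto simp: measure_def enn2real_positive_iff)
  qed (use sparse_packing_lebesgue[OF S T] sparse_packing_weight[OF S T w(2) Ainf] in auto)
qed

lemma average_product:
  assumes Q: "Q \<in> D" and \<sigma>: "weight \<sigma>" and p: "1 < p"
    and f: "f \<in> borel_measurable lebesgue" "\<And>x. 0 \<le> f x" "integrable (weight_measure \<sigma>) (\<lambda>x. f x powr p)"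
  shows "average (\<lambda>y. ennreal (f y * \<sigma> y)) Q = ennreal ((LINT y:Q|weight_measure \<sigma>. f y) / measure lebesgue Q)"
proof -
  interpret measured_family "{Q}" "weight_measure \<sigma>"
    using Q by (intro dyadic_measured_family \<sigma>) auto
  have Qs: "Q \<in> sets lebesgue" by (rule dyadic_cube_sets[OF D Q])
  have f': "f \<in> borel_measurable (weight_measure \<sigma>)"
    using f(1) measurable_cong_sets[OF sets_weight_measure refl] by blast
  have "(\<integral>\<^sup>+y\<in>Q. ennreal (f y * \<sigma> y) \<partial>lebesgue) = (\<integral>\<^sup>+y. ennreal ((indicator Q y * f y) * \<sigma> y) \<partial>lebesgue)"
    by (intro nn_integral_cong) (auto simp: indicator_def)
  also have "\<dots> = (\<integral>\<^sup>+y. ennreal (indicator Q y * f y) \<partial>weight_measure \<sigma>)"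
    using f Qs by (intro nn_integral_weight_measure[symmetric] \<sigma>) auto
  also have "\<dots> = ennreal (LINT y:Q|weight_measure \<sigma>. f y)"
    using set_integrable_of_powr[OF _ p f' f(2,3), of Q] f(2)
    unfolding set_lebesgue_integral_def set_integrable_def
    by (subst nn_integral_eq_integral) auto
  finally have "(\<integral>\<^sup>+y\<in>Q. ennreal (f y * \<sigma> y) \<partial>lebesgue) = ennreal (LINT y:Q|weight_measure \<sigma>. f y)" .
  moreover have "emeasure lebesgue Q = ennreal (measure lebesgue Q)"
    using dyadic_cube_finite[OF D Q] by (intro emeasure_eq_ennreal_measure) auto
  moreover have "0 < measure lebesgue Q"
    using dyadic_cube_pos[OF D Q] dyadic_cube_finite[OF D Q] by (simp add: measure_def enn2real_positive_iff)
  moreover have "0 \<le> (LINT y:Q|weight_measure \<sigma>. f y)"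
    unfolding set_lebesgue_integral_def using f(2) by (auto intro!: integral_nonneg)
  ultimately show ?thesis by (simp add: average_def divide_ennreal)
qed

end

section \<open>Passage to infinite families and the norm bound\<close>

text \<open>
  The last factors \<open>2\<^bsup>1/r\<^esup>\<close> and \<open>2\<^bsup>1/p\<^esup>\<close> come from the packing constants \<open>2 [w]\<close> and \<open>2 [\<sigma>]\<close>; the
  \<open>2\<close> divided by \<open>exponent_gap\<close> is the packing constant of Lebesgue measure.
\<close>

definition sparse_const :: "real \<Rightarrow> real \<Rightarrow> real" where
  "sparse_const p r = (if r < p
     then (2 * (2 * (2 / exponent_gap p r) * maximal_const p powr (r / p)
          * maximal_const (p / (p - r)) powr (1 - r / p) / (1 - (1 / 2) powr (r / p)))) powr (1 / r) * 2 powr (1 / r)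
     else maximal_const p powr (1 / p) * 2 powr (1 / p))"

lemma sparse_const_pos:
  assumes "1 < p" "0 < r" shows "0 < sparse_const p r"
proof (cases "r < p")
  case True
  have powr2: "0 < x powr (1 / r) * 2 powr (1 / r)" if "0 < x" for x :: real using that by simp
  have "1 < p / (p - r)" using assms True by (simp add: field_simps)
  then have m: "0 < maximal_const (p / (p - r))" by (rule maximal_const_pos)
  have "(1 / 2) powr (r / p) < (1 :: real)"
    using assms powr_less_mono2[of "r / p" "1/2" 1] by simp
  then have "0 < 2 * (2 * (2 / exponent_gap p r) * maximal_const p powr (r / p)
      * maximal_const (p / (p - r)) powr (1 - r / p) / (1 - (1 / 2) powr (r / p)))"
    using m maximal_const_pos[OF assms(1)] exponent_gap_pos[OF assms True] by simp
  then show ?thesis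
    unfolding sparse_const_def if_P[OF True] by (rule powr2)
next
  case False
  then show ?thesis using maximal_const_pos[OF assms(1)] by (simp add: sparse_const_def)
qed

lemma sparse_operator_finite:
  assumes T: "finite T" and r: "0 < r" and p: "0 < p"
    and c: "\<And>Q. Q \<in> T \<Longrightarrow> average (\<lambda>y. ennreal (g y)) Q = ennreal (c Q)" "\<And>Q. Q \<in> T \<Longrightarrow> 0 \<le> c Q"
  shows "ennpowr (sparse_operator T r g x) p = ennreal ((\<Sum>Q\<in>T. c Q powr r * indicator Q x) powr (p / r))"
proof -
  have "(\<Sum>\<^sub>\<infinity>Q\<in>T. ennpowr (average (\<lambda>y. ennreal (g y)) Q) r * indicator Q x)
      = (\<Sum>Q\<in>T. ennpowr (average (\<lambda>y. ennreal (g y)) Q) r * indicator Q x)"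
    using T by (rule infsum_finite)
  also have "\<dots> = (\<Sum>Q\<in>T. ennreal (c Q powr r * indicator Q x))"
    using c r by (intro sum.cong) (auto simp: ennpowr_ennreal indicator_def)
  also have "\<dots> = ennreal (\<Sum>Q\<in>T. c Q powr r * indicator Q x)"
    by (intro sum_ennreal) auto
  finally have "sparse_operator T r g x = ennpowr (ennreal (\<Sum>Q\<in>T. c Q powr r * indicator Q x)) (1 / r)"
    by (simp add: sparse_operator_def)
  moreover have "0 \<le> (\<Sum>Q\<in>T. c Q powr r * indicator Q x)" by (intro sum_nonneg) auto
  ultimately show ?thesis
    using r p by (simp add: ennpowr_ennpowr ennpowr_ennreal powr_powr)
qed

context
  fixes D :: "(real ^ 'n) set set"
  assumes D: "dyadic_system D"
begin

lemma dyadic_nonempty: "D \<noteq> {}"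
proof -
  obtain G where G: "D = (\<Union>k. G k)" and part: "\<forall>k. partition_on UNIV (G k)"
    and cubes: "\<forall>k. \<forall>Q\<in>G k. \<exists>a. Q = half_open_cube a (2 powi (- k))"
    and refine: "\<forall>k. \<forall>Q\<in>G (k + 1). \<exists>P\<in>G k. Q \<subseteq> P"
    by (rule dyadic_systemE[OF D])
  have "\<Union>(G 0) = UNIV" using part by (simp add: partition_on_def)
  then have "G 0 \<noteq> {}" by (metis Union_empty UNIV_not_empty)
  then show ?thesis using G by blast
qed

lemma finite_sparse_bound:
  assumes S: "S \<subseteq> D" "sparse_family S" and T: "finite T" "T \<subseteq> S" and w: "weight w" "weight \<sigma>"
    and p: "1 < p" and r: "0 < r"
    and Ap: "Ap_char D p w \<sigma> < \<infinity>" and Ainf: "Ainf_char D \<sigma> < \<infinity>" "r < p \<Longrightarrow> Ainf_char D w < \<infinity>"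
    and f: "f \<in> borel_measurable lebesgue" "\<And>x. 0 \<le> f x" "Lp_norm p \<sigma> (\<lambda>x. ennreal (f x)) < \<infinity>"
  shows "Lp_norm p w (sparse_operator T r (\<lambda>x. f x * \<sigma> x))
    \<le> ennreal (sparse_const p r) * ennpowr (Ap_char D p w \<sigma>) (1 / p)
        * (ennpowr (Ainf_char D w) (max (1 / r - 1 / p) 0) + ennpowr (Ainf_char D \<sigma>) (1 / p))
        * Lp_norm p \<sigma> (\<lambda>x. ennreal (f x))"
proof -
  let ?ms = "weight_measure \<sigma>" and ?mw = "weight_measure w" and ?L = "measure lebesgue"
  have TD: "T \<subseteq> D" using S T by blast
  define A where "A = enn2real (Ap_char D p w \<sigma>)"
  define as where "as = enn2real (Ainf_char D \<sigma>)"
  have A_eq: "Ap_char D p w \<sigma> = ennreal A" and as_eq: "Ainf_char D \<sigma> = ennreal as"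
    using Ap Ainf by (simp_all add: A_def as_def)
  have as0: "0 \<le> as" by (simp add: as_def)
  interpret F: two_weight_family T ?ms ?mw ?L 2 "2 * as"
    unfolding as_def by (rule dyadic_two_weight_family[OF D S T w Ainf(1)])
  have Apb: "ennreal (F.avg_w Q * F.avg_s Q powr (p - 1)) \<le> ennreal A" "0 < F.avg_w Q * F.avg_s Q powr (p - 1)"
    if "Q \<in> D" for Q
    using Ap_char_upper[OF D that w p] unfolding A_eq[symmetric] F.avg_w_def F.avg_s_def by auto
  have A0: "0 < A"
  proof -
    obtain Q where "Q \<in> D" using dyadic_nonempty by blast
    then have "0 < ennreal A" using Apb[of Q] by (metis ennreal_less_zero_iff order_less_le_trans)
    then show ?thesis by simp
  qed
  have Ap_real: "F.avg_w Q * F.avg_s Q powr (p - 1) \<le> A" if "Q \<in> T" for Q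
    using Apb[of Q] that TD A0 by (auto simp: ennreal_le_iff)
  have f': "f \<in> borel_measurable ?ms"
    using f(1) measurable_cong_sets[OF sets_weight_measure refl] by blast
  have fp: "ennpowr (ennreal (f x)) p = ennreal (f x powr p)" for x
    using f(2) p by (simp add: ennpowr_ennreal)
  have fint: "integrable ?ms (\<lambda>x. f x powr p)"
  proof (rule integrableI_nonneg)
    show "(\<lambda>x. f x powr p) \<in> borel_measurable ?ms" using f' by measurable
    show "(\<integral>\<^sup>+x. ennreal (f x powr p) \<partial>?ms) < \<infinity>"
    proof (rule ccontr)
      assume "\<not> (\<integral>\<^sup>+x. ennreal (f x powr p) \<partial>?ms) < \<infinity>"
      then have "(\<integral>\<^sup>+x. ennreal (f x powr p) \<partial>?ms) = top" by (metis infinity_ennreal_def less_top)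
      then show False using f(3) p unfolding Lp_norm_def fp by (simp add: ennpowr_top)
    qed
  qed simp
  define N where "N = (LINT x|?ms. f x powr p)"
  have N: "0 \<le> N" unfolding N_def by (auto intro!: integral_nonneg)
  have f_norm: "Lp_norm p \<sigma> (\<lambda>x. ennreal (f x)) = ennreal (N powr (1 / p))"
    unfolding Lp_norm_def fp N_def using fint p N unfolding N_def
    by (subst nn_integral_eq_integral) (auto simp: ennpowr_ennreal)
  define c where "c Q = (LINT y:Q|?ms. f y) / ?L Q" for Q
  have c: "average (\<lambda>y. ennreal (f y * \<sigma> y)) Q = ennreal (c Q)" "0 \<le> c Q" if "Q \<in> T" for Q
  proof -
    show "average (\<lambda>y. ennreal (f y * \<sigma> y)) Q = ennreal (c Q)"
      using that TD unfolding c_def by (intro average_product[OF D _ w(2) p f(1,2) fint]) auto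
    show "0 \<le> c Q"
      unfolding c_def set_lebesgue_integral_def using f(2)
      by (intro divide_nonneg_nonneg integral_nonneg) auto
  qed
  have op: "ennpowr (sparse_operator T r (\<lambda>x. f x * \<sigma> x) x) p = ennreal (F.family_sum r f x powr (p / r))" for x
    using sparse_operator_finite[OF T(1) r _ c, where p = p] p by (simp add: F.family_sum_def c_def)
  let ?X = "LINT x|?mw. F.family_sum r f x powr (p / r)"
  have X0: "0 \<le> ?X" by (auto intro!: integral_nonneg)
  have op_norm: "Lp_norm p w (sparse_operator T r (\<lambda>x. f x * \<sigma> x)) = ennreal (?X powr (1 / p))"
    unfolding Lp_norm_def op using F.integrable_family_sum_powr[of "p / r" r f] p r X0
    by (subst nn_integral_eq_integral) (auto simp: ennpowr_ennreal)
  have as_powr: "ennpowr (Ainf_char D \<sigma>) (1 / p) = ennreal (as powr (1 / p))"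
    and A_powr: "ennpowr (Ap_char D p w \<sigma>) (1 / p) = ennreal (A powr (1 / p))"
    unfolding as_eq A_eq using as0 A0 p by (simp_all add: ennpowr_ennreal)
  show ?thesis
  proof (cases "r < p")
    case True
    define aw where "aw = enn2real (Ainf_char D w)"
    have aw_eq: "Ainf_char D w = ennreal aw" and aw0: "0 \<le> aw"
      using Ainf(2)[OF True] by (simp_all add: aw_def)
    let ?e = "1 / r - 1 / p"
    have e: "0 < ?e" "?e \<le> 1 / r" using True r p by (auto simp: field_simps)
    have aw_powr: "ennpowr (Ainf_char D w) (max ?e 0) = ennreal (aw powr ?e)"
    proof -
      have "max ?e 0 = ?e" "?e \<noteq> 0" using e(1) by auto
      then show ?thesis unfolding aw_eq by (metis ennpowr_ennreal[OF aw0])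
    qed
    let ?C = "(2 * (2 * (2 / exponent_gap p r) * maximal_const p powr (r / p)
          * maximal_const (p / (p - r)) powr (1 - r / p) / (1 - (1 / 2) powr (r / p)))) powr (1 / r)"
    have "?X powr (1 / p) \<le> ?C * A powr (1 / p) * ((2 * aw) powr ?e + (2 * as) powr (1 / p)) * N powr (1 / p)"
      unfolding N_def
    proof (rule F.family_sum_bound_small_exponent[OF p r True A0 Ap_real f' f(2) fint])
      show "packing (2 * aw) T (measure ?mw)"
        unfolding aw_def by (rule sparse_packing_weight[OF D S T w(1) Ainf(2)[OF True]])
    qed (use aw0 in auto)
    also have "\<dots> \<le> ?C * A powr (1 / p) * (2 powr (1 / r) * (aw powr ?e + as powr (1 / p))) * N powr (1 / p)"
    proof (intro mult_right_mono mult_left_mono)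
      have "2 powr ?e * aw powr ?e \<le> 2 powr (1 / r) * aw powr ?e"
        "2 powr (1 / p) * as powr (1 / p) \<le> 2 powr (1 / r) * as powr (1 / p)"
        using e by (intro mult_right_mono powr_mono; simp)+
      then show "(2 * aw) powr ?e + (2 * as) powr (1 / p) \<le> 2 powr (1 / r) * (aw powr ?e + as powr (1 / p))"
        using aw0 as0 by (simp add: powr_mult distrib_left)
    qed auto
    also have "\<dots> = sparse_const p r * A powr (1 / p) * (aw powr ?e + as powr (1 / p)) * N powr (1 / p)"
      using True by (simp add: sparse_const_def mult_ac)
    finally have "ennreal (?X powr (1 / p))
        \<le> ennreal (sparse_const p r * A powr (1 / p) * (aw powr ?e + as powr (1 / p)) * N powr (1 / p))"
      by (rule ennreal_leI)
    also have "\<dots> = ennreal (sparse_const p r) * ennreal (A powr (1 / p))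
        * (ennreal (aw powr ?e) + ennreal (as powr (1 / p))) * ennreal (N powr (1 / p))"
      using sparse_const_pos[OF p r] by (simp add: ennreal_mult ennreal_plus)
    finally show ?thesis unfolding op_norm f_norm as_powr A_powr aw_powr .
  next
    case False
    then have max0: "max (1 / r - 1 / p) 0 = 0" using r p by (simp add: frac_le)
    have "?X powr (1 / p) \<le> maximal_const p powr (1 / p) * A powr (1 / p) * (2 * as) powr (1 / p) * N powr (1 / p)"
      unfolding N_def using False
      by (intro F.family_sum_bound_large_exponent[OF p _ A0 Ap_real f' f(2) fint]) auto
    also have "\<dots> = sparse_const p r * A powr (1 / p) * as powr (1 / p) * N powr (1 / p)"
      using False as0 by (simp add: sparse_const_def powr_mult mult_ac)
    finally have "ennreal (?X powr (1 / p))
        \<le> ennreal (sparse_const p r * A powr (1 / p) * as powr (1 / p) * N powr (1 / p))"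
      by (rule ennreal_leI)
    also have "\<dots> = ennreal (sparse_const p r) * ennreal (A powr (1 / p))
        * ennreal (as powr (1 / p)) * ennreal (N powr (1 / p))"
      using sparse_const_pos[OF p r] by (simp add: ennreal_mult)
    also have "\<dots> \<le> ennreal (sparse_const p r) * ennreal (A powr (1 / p))
        * (1 + ennreal (as powr (1 / p))) * ennreal (N powr (1 / p))"
      by (intro mult_right_mono mult_left_mono) auto
    finally show ?thesis unfolding op_norm f_norm as_powr A_powr max0 ennpowr_0 .
  qed
qed

text \<open>
  A countable family is exhausted by an increasing sequence of finite ones, and monotone convergence
  applies to the sum and then to the integral.
\<close>

lemma sparse_operator_limit:
  assumes S: "S \<subseteq> D" and p: "0 < p" and r: "0 < r"
    and bound: "\<And>T. finite T \<Longrightarrow> T \<subseteq> S \<Longrightarrow> Lp_norm p w (sparse_operator T r g) \<le> B"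
  shows "Lp_norm p w (sparse_operator S r g) \<le> B"
proof (cases "finite S")
  case False
  have count: "countable S" using dyadic_system_countable[OF D] S by (rule countable_subset[rotated])
  define T where "T n = from_nat_into S ` {..<n}" for n :: nat
  have T: "finite (T n)" "T n \<subseteq> S" for n
    using from_nat_into[of S] False by (auto simp: T_def)
  have T_mono: "T m \<subseteq> T n" if "m \<le> n" for m n using that by (auto simp: T_def)
  have T_cover: "\<exists>n. U \<subseteq> T n" if "finite U" "U \<subseteq> S" for U
    using that
  proof (induction U rule: finite_induct)
    case (insert Q U)
    then obtain n where n: "U \<subseteq> T n" by auto
    obtain m where m: "Q = from_nat_into S m"
      using insert.prems count from_nat_into_surj[OF count, of Q] by auto
    have "insert Q U \<subseteq> T (max n (Suc m))"
      using n T_mono[of n "max n (Suc m)"] by (auto simp: T_def m)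
    then show ?case ..
  qed simp
  let ?t = "\<lambda>x Q. ennpowr (average (\<lambda>y. ennreal (g y)) Q) r * indicator Q x"
  have infsum_SUP: "(\<Sum>\<^sub>\<infinity>Q\<in>S. ?t x Q) = (SUP n. \<Sum>Q\<in>T n. ?t x Q)" for x
  proof -
    have "(\<Sum>\<^sub>\<infinity>Q\<in>S. ?t x Q) = (SUP U\<in>{U. finite U \<and> U \<subseteq> S}. \<Sum>Q\<in>U. ?t x Q)"
      by (rule nonneg_infsum_complete) simp
    also have "\<dots> = (SUP n. \<Sum>Q\<in>T n. ?t x Q)"
    proof (rule antisym)
      show "(SUP U\<in>{U. finite U \<and> U \<subseteq> S}. \<Sum>Q\<in>U. ?t x Q) \<le> (SUP n. \<Sum>Q\<in>T n. ?t x Q)"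
      proof (rule SUP_least)
        fix U assume "U \<in> {U. finite U \<and> U \<subseteq> S}"
        then obtain n where "U \<subseteq> T n" using T_cover by blast
        then have "(\<Sum>Q\<in>U. ?t x Q) \<le> (\<Sum>Q\<in>T n. ?t x Q)"
          using T by (intro sum_mono2) auto
        also have "\<dots> \<le> (SUP n. \<Sum>Q\<in>T n. ?t x Q)" by (rule SUP_upper) simp
        finally show "(\<Sum>Q\<in>U. ?t x Q) \<le> (SUP n. \<Sum>Q\<in>T n. ?t x Q)" .
      qed
      show "(SUP n. \<Sum>Q\<in>T n. ?t x Q) \<le> (SUP U\<in>{U. finite U \<and> U \<subseteq> S}. \<Sum>Q\<in>U. ?t x Q)"
        using T by (intro SUP_mono) blast
    qed
    finally show ?thesis .
  qed
  have op_T: "sparse_operator (T n) r g x = ennpowr (\<Sum>Q\<in>T n. ?t x Q) (1 / r)" for n x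
    by (simp add: sparse_operator_def infsum_finite[OF T(1)])
  have op_SUP: "ennpowr (sparse_operator S r g x) p = (SUP n. ennpowr (sparse_operator (T n) r g x) p)" for x
    unfolding op_T unfolding sparse_operator_def infsum_SUP using p r by (simp add: ennpowr_SUP)
  have meas: "(\<lambda>x. ennpowr (sparse_operator (T n) r g x) p) \<in> borel_measurable (weight_measure w)" for n
  proof -
    have "Q \<in> sets (weight_measure w)" if "Q \<in> T n" for Q
      using dyadic_cube_sets[OF D] that T(2) S by auto
    then have "(\<lambda>x. \<Sum>Q\<in>T n. ?t x Q) \<in> borel_measurable (weight_measure w)"
      by (intro borel_measurable_sum borel_measurable_times_ennreal borel_measurable_indicator borel_measurable_const)
    then show ?thesis unfolding op_T by measurable
  qed
  have inc: "incseq (\<lambda>n x. ennpowr (sparse_operator (T n) r g x) p)"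
    unfolding op_T using T T_mono p r
    by (intro monoI le_funI ennpowr_mono sum_mono2) auto
  have "Lp_norm p w (sparse_operator S r g)
      = ennpowr (SUP n. \<integral>\<^sup>+x. ennpowr (sparse_operator (T n) r g x) p \<partial>weight_measure w) (1 / p)"
    unfolding Lp_norm_def op_SUP using nn_integral_monotone_convergence_SUP[OF inc meas] by simp
  also have "\<dots> = (SUP n. Lp_norm p w (sparse_operator (T n) r g))"
    unfolding Lp_norm_def using p by (simp add: ennpowr_SUP)
  also have "\<dots> \<le> B" using T bound by (intro SUP_least) auto
  finally show ?thesis .
qed (use bound in simp)

text \<open>
  When the norm of \<open>f\<close> vanishes, an infinite right-hand side in the main estimate still gives the bound
  \<open>\<infinity> \<cdot> 0 = 0\<close>, which is met because \<open>f \<sigma>\<close> vanishes almost everywhere.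
\<close>

lemma sparse_operator_null:
  assumes S: "S \<subseteq> D" and p: "0 < p" and r: "0 < r" and \<sigma>: "weight \<sigma>"
    and f: "f \<in> borel_measurable lebesgue" "\<And>x. 0 \<le> f x" "Lp_norm p \<sigma> (\<lambda>x. ennreal (f x)) = 0"
  shows "Lp_norm p w (sparse_operator S r (\<lambda>x. f x * \<sigma> x)) = 0"
proof -
  have "AE x in weight_measure \<sigma>. ennpowr (ennreal (f x)) p = 0"
  proof -
    have "(\<integral>\<^sup>+x. ennpowr (ennreal (f x)) p \<partial>weight_measure \<sigma>) = ennpowr (Lp_norm p \<sigma> (\<lambda>x. ennreal (f x))) p"
      unfolding Lp_norm_def using p by (simp add: ennpowr_ennpowr)
    also have "\<dots> = 0" using f(3) p by (simp add: ennpowr_zero)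
    finally show ?thesis
      using f(1) measurable_cong_sets[OF sets_weight_measure refl, of \<sigma>]
      by (subst (asm) nn_integral_0_iff_AE) auto
  qed
  then have "AE x in weight_measure \<sigma>. f x = 0"
    by eventually_elim (use f(2) p in \<open>auto simp: ennpowr_ennreal\<close>)
  then have ae: "AE x in lebesgue. ennreal (f x * \<sigma> x) = 0"
    unfolding weight_measure_def using weight_measurable[OF \<sigma>]
    by (subst (asm) AE_density) (auto elim!: eventually_mono simp: ennreal_eq_0_iff mult_nonneg_nonpos f(2) not_less)
  have "average (\<lambda>y. ennreal (f y * \<sigma> y)) Q = 0" for Q
  proof -
    have "(\<integral>\<^sup>+y\<in>Q. ennreal (f y * \<sigma> y) \<partial>lebesgue) = (\<integral>\<^sup>+y. 0 \<partial>(lebesgue :: (real ^ 'n) measure))"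
      using ae by (intro nn_integral_cong_AE) auto
    then show ?thesis by (simp add: average_def)
  qed
  then have "sparse_operator S r (\<lambda>x. f x * \<sigma> x) = (\<lambda>x. 0)"
    using r by (simp add: sparse_operator_def ennpowr_zero fun_eq_iff)
  then show ?thesis using p by (simp add: Lp_norm_def ennpowr_zero)
qed

end

theorem theorem1p1:
  fixes D :: "(real ^ 'n) set set" and p r :: real
  assumes "dyadic_system D" and "1 < p" and "0 < r"
  shows "\<exists>C::real. 0 < C \<and>
    (\<forall>S w \<sigma>. S \<subseteq> D \<and> sparse_family S \<and> weight w \<and> weight \<sigma> \<longrightarrow>
       sparse_operator_norm S r p \<sigma> w
         \<le> ennreal C * ennpowr (Ap_char D p w \<sigma>) (1 / p)
             * (ennpowr (Ainf_char D w) (max (1 / r - 1 / p) 0) + ennpowr (Ainf_char D \<sigma>) (1 / p)))"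
proof (intro exI conjI allI impI)
  show "0 < sparse_const p r" by (rule sparse_const_pos[OF assms(2,3)])
  fix S :: "(real ^ 'n) set set" and w \<sigma> :: "real ^ 'n \<Rightarrow> real"
  assume asm: "S \<subseteq> D \<and> sparse_family S \<and> weight w \<and> weight \<sigma>"
  then have S: "S \<subseteq> D" "sparse_family S" and w: "weight w" "weight \<sigma>" by auto
  let ?B = "ennreal (sparse_const p r) * ennpowr (Ap_char D p w \<sigma>) (1 / p)
    * (ennpowr (Ainf_char D w) (max (1 / r - 1 / p) 0) + ennpowr (Ainf_char D \<sigma>) (1 / p))"
  obtain Q where Q: "Q \<in> D" using dyadic_nonempty[OF assms(1)] by blast
  have pos_powr: "0 < ennpowr x a" if "0 < x" "0 \<le> a" for x a
    using that by (cases x; cases "a = 0") (auto simp: ennpowr_ennreal ennpowr_top)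
  have Ap0: "0 < Ap_char D p w \<sigma>"
    using Ap_char_upper[OF assms(1) Q w assms(2)] by (meson ennreal_less_zero_iff order_less_le_trans)
  have Ai0: "0 < Ainf_char D v" if "weight v" for v
    using Ainf_char_ge_1[OF assms(1) that Q] by (rule order_less_le_trans[rotated]) simp
  have top: "?B = top" if "\<not> (Ap_char D p w \<sigma> < \<infinity> \<and> Ainf_char D \<sigma> < \<infinity> \<and> (r < p \<longrightarrow> Ainf_char D w < \<infinity>))"
  proof -
    have C: "0 < ennreal (sparse_const p r)" using sparse_const_pos[OF assms(2,3)] by simp
    have P: "0 < ennpowr (Ap_char D p w \<sigma>) (1 / p)" using Ap0 assms by (intro pos_powr) auto
    have I: "0 < ennpowr (Ainf_char D \<sigma>) (1 / p)" using Ai0[OF w(2)] assms by (intro pos_powr) auto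
    have "r < p \<Longrightarrow> max (1 / r - 1 / p) 0 \<noteq> 0" using assms(2,3) by (simp add: max_def field_simps)
    moreover have "Ap_char D p w \<sigma> = top \<or> Ainf_char D \<sigma> = top \<or> r < p \<and> Ainf_char D w = top"
      using that by (metis infinity_ennreal_def less_top)
    ultimately consider "ennpowr (Ap_char D p w \<sigma>) (1 / p) = top" | "ennpowr (Ainf_char D \<sigma>) (1 / p) = top"
      | "ennpowr (Ainf_char D w) (max (1 / r - 1 / p) 0) = top"
      using assms(2) by (auto simp: ennpowr_top)
    then show ?thesis
      using C P I by cases (auto simp: ennreal_mult_eq_top_iff)
  qed
  show "sparse_operator_norm S r p \<sigma> w \<le> ?B"
    unfolding sparse_operator_norm_def
  proof (rule Inf_lower, safe)
    fix f :: "real ^ 'n \<Rightarrow> real"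
    assume f: "f \<in> borel_measurable lebesgue" "\<forall>x. 0 \<le> f x" "Lp_norm p \<sigma> (\<lambda>x. ennreal (f x)) < \<infinity>"
    show "Lp_norm p w (sparse_operator S r (\<lambda>x. f x * \<sigma> x)) \<le> ?B * Lp_norm p \<sigma> (\<lambda>x. ennreal (f x))"
    proof (cases "Ap_char D p w \<sigma> < \<infinity> \<and> Ainf_char D \<sigma> < \<infinity> \<and> (r < p \<longrightarrow> Ainf_char D w < \<infinity>)")
      case True
      show ?thesis
      proof (rule sparse_operator_limit[OF assms(1) S(1)])
        fix T assume T: "finite T" "T \<subseteq> S"
        show "Lp_norm p w (sparse_operator T r (\<lambda>x. f x * \<sigma> x)) \<le> ?B * Lp_norm p \<sigma> (\<lambda>x. ennreal (f x))"
          using True f by (intro finite_sparse_bound[OF assms(1) S T w assms(2,3)]) auto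
      qed (use assms in auto)
    next
      case False
      show ?thesis
      proof (cases "Lp_norm p \<sigma> (\<lambda>x. ennreal (f x)) = 0")
        case True
        then show ?thesis
          using sparse_operator_null[OF assms(1) S(1) _ assms(3) w(2) f(1) _ True] f(2) assms(2) by simp
      next
        case norm: False
        then show ?thesis unfolding top[OF False] by (simp add: ennreal_top_mult)
      qed
    qed
  qed
qed

end
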